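(* Let $\tilde f(G_1,G_2)$ be a function on the space of ordered pairs of lines of the plane, integrable with respect to $dG_1\,dG_2$. The measure $\tilde f(G_1,G_2)\,dG_1\,dG_2$ is invariant under the group of Euclidean motions if and only if $\tilde f(G_1,G_2)=\tilde f(p_1,\varphi_1,p_2,\varphi_2)=f(\varphi_2-\varphi_1)$ with $f$ a $\pi$-periodic function on $\mathbb{R}$, where $(p_i,\varphi_i)$ are the coordinates of $G_i$.
   Context: For a straight line $G$ of the plane $\mathbb{R}^2$ that does not pass through the origin, let $P$ be the point of $G$ at minimum distance from the origin; the coordinates of $G$ are the polar coordinates $(p,\varphi)$ of $P$, with $p>0$ and $0\le\varphi<2\pi$. On the set of lines not containing the origin one takes the measure $dG=dp\,d\varphi$ (the invariant measure on lines, up to a constant multiple), and on the space of ordered pairs of lines $(G_1,G_2)$ the canonical measure $dG_1\,dG_2=dp_1\,d\varphi_1\,dp_2\,d\varphi_2$, which is invariant under Euclidean motions. The measure with density $\tilde f$, written $\tilde f(G_1,G_2)\,dG_1\,dG_2$, assigns to a set $A$ of pairs of lines the value $\int_A \tilde f(G_1,G_2)\,dG_1\,dG_2$. Euclidean motions of the plane act on pairs of lines by moving both lines simultaneously, and invariance of the measure is with respect to this action.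
   Formalization: The identity with f(φ₂−φ₁) holds almost everywhere (pointwise it fails, e.g. for the indicator of one pair of lines); motions are rotations and translations without reflections; integrability is only required over pairs of lines meeting a disc, which is more general. *)

theory Defs
  imports "HOL-Analysis.Analysis"
begin

type_synonym plane = "real^2"

definition lines_off_origin :: "plane set set" where
  "lines_off_origin = {G. affine G \<and> aff_dim G = 1 \<and> 0 \<notin> G}"

definition polar_point :: "real \<times> real \<Rightarrow> plane" where
  "polar_point = (\<lambda>(p, \<phi>). vector [p * cos \<phi>, p * sin \<phi>])"

definition coord_domain :: "(real \<times> real) set" where
  "coord_domain = {0<..} \<times> {0..<2 * pi}"

definition line_coords :: "plane set \<Rightarrow> real \<times> real" where
  "line_coords G = (THE c. c \<in> coord_domain \<and> polar_point c = closest_point G 0)"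

text \<open>The measure $dG = dp\,d\varphi$: Lebesgue measure on the coordinate domain, transported
  to the lines along the inverse of the coordinate map.\<close>

definition line_measure :: "plane set measure" where
  "line_measure = embed_measure (restrict_space lborel coord_domain)
     (the_inv_into lines_off_origin line_coords)"

definition line_pair_measure :: "(plane set \<times> plane set) measure" where
  "line_pair_measure = line_measure \<Otimes>\<^sub>M line_measure"

text \<open>Motions are orientation preserving: compositions of rotations and translations.
  A reflection would replace $\varphi_2 - \varphi_1$ by its negative.\<close>

definition euclidean_motion :: "(plane \<Rightarrow> plane) \<Rightarrow> bool" where
  "euclidean_motion g \<longleftrightarrow> (\<exists>Q b. rotation_matrix Q \<and> g = (\<lambda>x. Q *v x + b))"

definition move_pairs :: "(plane \<Rightarrow> plane) \<Rightarrow> (plane set \<times> plane set) set \<Rightarrow> (plane set \<times> plane set) set"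
  where "move_pairs g A = (\<lambda>(G\<^sub>1, G\<^sub>2). (g ` G\<^sub>1, g ` G\<^sub>2)) ` A"

text \<open>A density need only be integrable on the pairs of lines meeting a fixed disc. A nonzero
  function of $\varphi_2 - \varphi_1$ alone is never integrable over the whole space of pairs.\<close>

definition locally_integrable_pairs :: "(plane set \<times> plane set \<Rightarrow> real) \<Rightarrow> bool" where
  "locally_integrable_pairs f \<longleftrightarrow>
     (\<forall>R. set_integrable line_pair_measure
        {(G\<^sub>1, G\<^sub>2). G\<^sub>1 \<inter> cball 0 R \<noteq> {} \<and> G\<^sub>2 \<inter> cball 0 R \<noteq> {}} f)"

text \<open>The density may change sign, so its measure is the set function taking \<open>A\<close> to the integral
  of \<open>f\<close> over \<open>A\<close>, defined where that integral exists. The set \<open>move_pairs g A\<close> may contain pairs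
  with a line through the origin; these form a null set and lie outside the space of
  \<open>line_pair_measure\<close>, so the integral ignores them.\<close>

definition motion_invariant_density :: "(plane set \<times> plane set \<Rightarrow> real) \<Rightarrow> bool" where
  "motion_invariant_density f \<longleftrightarrow>
     (\<forall>g A. euclidean_motion g \<longrightarrow> A \<in> sets line_pair_measure \<longrightarrow>
        set_integrable line_pair_measure A f \<longrightarrow>
        set_integrable line_pair_measure (move_pairs g A) f \<and>
        set_lebesgue_integral line_pair_measure (move_pairs g A) f =
          set_lebesgue_integral line_pair_measure A f)"

end

theory Submission
  imports Defs "HOL-Library.Real_Mod"
begin

text \<open>
Write the line with coordinates \<open>(p, \<phi>)\<close> in Hesse normal form
\<open>x \<bullet> (cos \<phi>, sin \<phi>) = p\<close>. This makes sense for every real \<open>p\<close> and \<open>\<phi>\<close>, and \<open>(p, \<phi> + \<pi>)\<close> and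
\<open>(- p, \<phi>)\<close> give the same line. In these redundant coordinates the rotation by \<open>\<alpha>\<close> followed by the
translation by \<open>b\<close> is the map \<open>shift\<close>, which sends \<open>\<phi>\<close> to \<open>\<phi> + \<alpha>\<close> and then adds
\<open>b \<bullet> (cos (\<phi> + \<alpha>), sin (\<phi> + \<alpha>))\<close> to \<open>p\<close>. Integrating over lines amounts to integrating over
all real \<open>p\<close> and over one period \<open>{0..<pi}\<close> of \<open>\<phi>\<close> (\<open>nn_integral_line_measure\<close>), so translations
of \<open>p\<close> and shifts of a periodic function show that the measure on lines, and hence the one on pairs,
is invariant (\<open>distr_move_line\<close>, \<open>distr_move_line_pair\<close>). Consequently the measure with a measurable
density \<open>F\<close> is invariant exactly if, for each motion \<open>g\<close>, the functions \<open>F \<circ> g\<close> and \<open>F\<close> agree almost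
everywhere (\<open>motion_invariant_density_iff\<close>).

If \<open>F\<close> is a \<open>\<pi>\<close>-periodic function of the angle difference, this holds because a motion changes that
difference only by a multiple of \<open>\<pi>\<close> (\<open>line_angle_motion\<close>).

Conversely, a motion fixes the angle \<open>\<delta> = \<psi> - \<phi>\<close> of a pair \<open>((p, \<phi>), (q, \<psi>))\<close> in redundant
coordinates, and when \<open>sin \<delta> \<noteq> 0\<close> the motions act transitively on the pairs with a given \<open>\<delta>\<close>: the
rotation angle is determined by the first angles, and the translation solves a linear system with
determinant \<open>sin \<delta>\<close>. To turn invariance almost everywhere into dependence on \<open>\<delta>\<close> almost everywhere,
consider the smooth map \<open>transit\<close> that takes a motion and a pair to the angle \<open>\<delta>\<close>, the pair and its
image. It goes from a seven-dimensional space to a seven-dimensional space, and its range contains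
everything with \<open>sin \<delta> \<noteq> 0\<close>. Differentiable maps between spaces of equal dimension send null sets to
null sets, so for almost all \<open>\<delta>\<close> and almost all pairs of points of the fibre over \<open>\<delta>\<close> the two values
of \<open>F\<close> agree. Thus \<open>F\<close> is almost everywhere equal to a constant on almost every fibre, and \<open>f \<delta>\<close> is
this constant. The relation between \<open>(q, \<psi> + \<pi>)\<close> and \<open>(- q, \<psi>)\<close> carries the fibre over
\<open>\<delta> + \<pi>\<close> to the fibre over \<open>\<delta>\<close> by a reflection, which makes \<open>f\<close> periodic at every point
(\<open>shift_invariant_imp_angle_function\<close>).
\<close>

section \<open>Lines in normal form\<close>

definition hesse_line :: "real \<Rightarrow> real \<Rightarrow> plane set" where
  "hesse_line p \<phi> = {x. x$1 * cos \<phi> + x$2 * sin \<phi> = p}"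

lemma hesse_line_add_2pi: "hesse_line p (\<phi> + 2 * pi * of_int k) = hesse_line p \<phi>"
proof -
  have "sin (\<phi> + 2 * pi * of_int k) = sin \<phi> \<and> cos (\<phi> + 2 * pi * of_int k) = cos \<phi>"
    by (subst sin_cos_eq_iff) blast
  then show ?thesis by (simp add: hesse_line_def)
qed

lemma hesse_line_add_pi: "hesse_line p (\<phi> + pi) = hesse_line (- p) \<phi>"
  by (auto simp: hesse_line_def)

lemma zero_in_hesse_line_iff: "0 \<in> hesse_line p \<phi> \<longleftrightarrow> p = 0"
  by (auto simp: hesse_line_def)

lemma hesse_line_eq_hyperplane: "hesse_line p \<phi> = {x. vector [cos \<phi>, sin \<phi>] \<bullet> x = p}"
  by (simp add: hesse_line_def inner_vec_def sum_2 vector_2 mult.commute)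

lemma unit_vector_neq_0: "vector [cos \<phi>, sin \<phi>] \<noteq> (0::plane)"
proof
  assume "vector [cos \<phi>, sin \<phi>] = (0::plane)"
  then have "cos \<phi> = 0" "sin \<phi> = 0"
    by (metis vector_2(1) zero_index, metis vector_2(2) zero_index)
  then show False using sin_cos_squared_add[of \<phi>] by simp
qed

lemma hesse_line_off_origin:
  assumes "p \<noteq> 0"
  shows "hesse_line p \<phi> \<in> lines_off_origin"
proof -
  have "affine (hesse_line p \<phi>)"
    unfolding hesse_line_eq_hyperplane by (rule affine_hyperplane)
  moreover have "aff_dim (hesse_line p \<phi>) = 1"
    unfolding hesse_line_eq_hyperplane using unit_vector_neq_0 by (subst aff_dim_hyperplane) auto
  ultimately show ?thesis
    using assms by (simp add: lines_off_origin_def zero_in_hesse_line_iff)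
qed

text \<open>A point \<open>z\<close> of the line satisfies \<open>\<bar>z\<bar>\<^sup>2 = p\<^sup>2 + t\<^sup>2\<close>, where \<open>t\<close> is its signed distance from the foot of
the perpendicular, \<open>(p cos \<phi>, p sin \<phi>)\<close>.\<close>

lemma closest_point_hesse_line: "closest_point (hesse_line p \<phi>) 0 = polar_point (p, \<phi>)"
proof (rule closest_point_unique[symmetric])
  show "convex (hesse_line p \<phi>)" "closed (hesse_line p \<phi>)"
    unfolding hesse_line_eq_hyperplane by (rule convex_hyperplane, rule closed_hyperplane)
  have *: "p * cos \<phi> * cos \<phi> + p * sin \<phi> * sin \<phi> = p"
    using sin_cos_squared_add[of \<phi>] by algebra
  then show "polar_point (p, \<phi>) \<in> hesse_line p \<phi>"
    by (simp add: hesse_line_def polar_point_def)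
  show "\<forall>z\<in>hesse_line p \<phi>. dist 0 (polar_point (p, \<phi>)) \<le> dist 0 z"
  proof
    fix z assume "z \<in> hesse_line p \<phi>"
    then have z: "z$1 * cos \<phi> + z$2 * sin \<phi> = p" by (simp add: hesse_line_def)
    have "(p * cos \<phi>)\<^sup>2 + (p * sin \<phi>)\<^sup>2 = p\<^sup>2"
      using sin_cos_squared_add[of \<phi>] by algebra
    also have "(z$1)\<^sup>2 + (z$2)\<^sup>2 = p\<^sup>2 + (z$1 * sin \<phi> - z$2 * cos \<phi>)\<^sup>2"
      unfolding z[symmetric] using sin_cos_squared_add[of \<phi>] by algebra
    then have "p\<^sup>2 \<le> (z$1)\<^sup>2 + (z$2)\<^sup>2" by simp
    finally show "dist 0 (polar_point (p, \<phi>)) \<le> dist 0 z"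
      by (simp add: norm_vec_def L2_set_def sum_2 polar_point_def)
  qed
qed

lemma inj_on_polar_point: "inj_on polar_point coord_domain"
proof (rule inj_onI, clarify)
  fix p \<phi> q \<psi>
  assume D: "(p, \<phi>) \<in> coord_domain" "(q, \<psi>) \<in> coord_domain"
    and eq: "polar_point (p, \<phi>) = polar_point (q, \<psi>)"
  have c: "p * cos \<phi> = q * cos \<psi>" and s: "p * sin \<phi> = q * sin \<psi>"
    using arg_cong[OF eq, of "\<lambda>x. x$1"] arg_cong[OF eq, of "\<lambda>x. x$2"]
    by (simp_all add: polar_point_def)
  have pos: "p > 0" "q > 0" using D by (auto simp: coord_domain_def)
  have "p\<^sup>2 = q\<^sup>2"
    using c s sin_cos_squared_add[of \<phi>] sin_cos_squared_add[of \<psi>] by algebra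
  with pos have pq: "p = q" by simp
  with c s pos have "sin \<phi> = sin \<psi> \<and> cos \<phi> = cos \<psi>" by simp
  then obtain n :: int where n: "\<phi> = \<psi> + 2 * pi * n" by (auto simp: sin_cos_eq_iff)
  have "\<bar>2 * pi * n\<bar> < 2 * pi * 1" using D n by (auto simp: coord_domain_def)
  then have "\<bar>real_of_int n\<bar> < 1" by (simp add: abs_mult)
  then have "n = 0" by linarith
  with n pq show "p = q \<and> \<phi> = \<psi>" by simp
qed

lemma line_coords_hesse_line:
  assumes "(p, \<phi>) \<in> coord_domain"
  shows "line_coords (hesse_line p \<phi>) = (p, \<phi>)"
  unfolding line_coords_def closest_point_hesse_line
  using assms inj_on_polar_point by (intro the_equality) (auto dest: inj_onD)

text \<open>The representative of redundant coordinates in \<open>coord_domain\<close>. At \<open>p = 0\<close>, where the line passes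
through the origin, the value \<open>(1, 0)\<close> is an arbitrary point of that domain.\<close>

definition std_coords :: "real \<times> real \<Rightarrow> real \<times> real" where
  "std_coords = (\<lambda>(p, \<phi>). if p = 0 then (1, 0)
     else if p > 0 then (p, \<phi> rmod (2 * pi)) else (- p, (\<phi> + pi) rmod (2 * pi)))"

lemma rmod_2pi_bounds: "0 \<le> x rmod (2 * pi)" "x rmod (2 * pi) < 2 * pi"
  by (auto intro: rmod_nonneg rmod_less simp: rmod_nonneg)

lemma std_coords_in_domain: "std_coords c \<in> coord_domain"
  using rmod_2pi_bounds
  by (auto simp: std_coords_def coord_domain_def split: prod.splits)

lemma hesse_line_rmod: "hesse_line p (\<phi> rmod (2 * pi)) = hesse_line p \<phi>"
proof -
  have "\<phi> rmod (2 * pi) = \<phi> + 2 * pi * of_int (- \<lfloor>\<phi> / (2 * pi)\<rfloor>)"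
    by (simp add: rmod_def)
  then show ?thesis by (metis hesse_line_add_2pi)
qed

lemma hesse_line_std_coords:
  assumes "fst c \<noteq> 0"
  shows "case_prod hesse_line (std_coords c) = case_prod hesse_line c"
proof (cases c)
  case (Pair p \<phi>)
  then show ?thesis using assms hesse_line_add_pi[of "- p" \<phi>]
    by (auto simp: std_coords_def hesse_line_rmod)
qed

lemma std_coords_id: "c \<in> coord_domain \<Longrightarrow> std_coords c = c"
  by (auto simp: std_coords_def coord_domain_def intro!: rmod_idem)

lemma hyperplane_eq_hesse_line:
  fixes a :: plane
  assumes "a \<noteq> 0"
  shows "\<exists>p \<phi>. {x. a \<bullet> x = b} = hesse_line p \<phi>"
proof -
  obtain r t where rt: "a$1 = r * cos t" "a$2 = r * sin t" using polar_Ex by metis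
  have "r \<noteq> 0" using assms rt by (auto simp: vec_eq_iff forall_2)
  have "a \<bullet> x = r * (x$1 * cos t + x$2 * sin t)" for x
    by (simp add: inner_vec_def sum_2 rt algebra_simps)
  with \<open>r \<noteq> 0\<close> have "{x. a \<bullet> x = b} = hesse_line (b / r) t"
    by (auto simp: hesse_line_def field_simps)
  then show ?thesis by blast
qed

text \<open>A line is a hyperplane \<open>a \<bullet> x = b\<close> of the plane. Writing \<open>a\<close> as \<open>r (cos t, sin t)\<close> and dividing by \<open>r\<close>
gives redundant coordinates, which \<open>std_coords\<close> moves into \<open>coord_domain\<close>.\<close>

lemma lines_off_origin_eq: "lines_off_origin = case_prod hesse_line ` coord_domain"
proof (intro equalityI subsetI)
  fix G assume G: "G \<in> lines_off_origin"
  then have "affine hull G = G" "aff_dim G = DIM(plane) - 1"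
    by (auto simp: lines_off_origin_def)
  then obtain a b where ab: "a \<noteq> 0" "G = {x. a \<bullet> x = b}"
    by (metis aff_dim_eq_hyperplane)
  then obtain p \<phi> where pf: "G = hesse_line p \<phi>" using hyperplane_eq_hesse_line by metis
  with G have "p \<noteq> 0" by (auto simp: lines_off_origin_def zero_in_hesse_line_iff)
  then have "G = case_prod hesse_line (std_coords (p, \<phi>))"
    by (simp add: hesse_line_std_coords pf)
  then show "G \<in> case_prod hesse_line ` coord_domain" using std_coords_in_domain by blast
qed (auto simp: coord_domain_def intro: hesse_line_off_origin)

lemma bij_betw_line_coords: "bij_betw line_coords lines_off_origin coord_domain"
  unfolding lines_off_origin_eq bij_betw_def
  by (force simp: image_image line_coords_hesse_line intro!: inj_onI)

lemma the_inv_into_line_coords: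
  assumes "c \<in> coord_domain"
  shows "the_inv_into lines_off_origin line_coords c = case_prod hesse_line c"
  using assms bij_betw_line_coords
  by (intro the_inv_into_f_eq)
     (auto simp: bij_betw_def lines_off_origin_eq line_coords_hesse_line split: prod.splits)

text \<open>Normalising redundant coordinates changes the angle by a multiple of \<open>2\<pi>\<close>, and by a further \<open>\<pi>\<close> when
the sign of \<open>p\<close> has to be reversed.\<close>

lemma snd_line_coords_hesse_line:
  assumes "p \<noteq> 0"
  shows "\<exists>k::int. snd (line_coords (hesse_line p \<phi>)) = \<phi> + pi * of_int k"
proof -
  obtain p' \<phi>' where c: "std_coords (p, \<phi>) = (p', \<phi>')" by force
  then have "line_coords (hesse_line p \<phi>) = (p', \<phi>')"
    using hesse_line_std_coords[of "(p, \<phi>)"] assms std_coords_in_domain[of "(p, \<phi>)"]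
    by (simp add: line_coords_hesse_line flip: \<open>_ = (p', \<phi>')\<close>)
       (metis c line_coords_hesse_line case_prod_conv)
  moreover have "\<exists>k::int. \<phi>' = \<phi> + pi * of_int k"
  proof (cases "p > 0")
    case True
    then have "\<phi>' = \<phi> + pi * of_int (- 2 * \<lfloor>\<phi> / (2 * pi)\<rfloor>)"
      using c by (simp add: std_coords_def rmod_def)
    then show ?thesis by blast
  next
    case False
    then have "\<phi>' = \<phi> + pi * of_int (1 - 2 * \<lfloor>(\<phi> + pi) / (2 * pi)\<rfloor>)"
      using c assms by (auto simp: std_coords_def rmod_def algebra_simps)
    then show ?thesis by blast
  qed
  ultimately show ?thesis by simp
qed

text \<open>A parametrisation of the lines off the origin by the whole plane of redundant coordinates. The default
line at \<open>p = 0\<close> keeps all values in the space of lines, which measurability requires.\<close>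

definition chart :: "real \<times> real \<Rightarrow> plane set" where
  "chart c = case_prod hesse_line (std_coords c)"

lemma chart_eq_hesse_line: "fst c \<noteq> 0 \<Longrightarrow> chart c = case_prod hesse_line c"
  by (simp add: chart_def hesse_line_std_coords)

lemma fst_std_coords_neq_0: "fst (std_coords c) \<noteq> 0"
  using std_coords_in_domain[of c] by (auto simp: coord_domain_def)

lemma chart_std_coords: "chart (std_coords c) = chart c"
  by (simp add: chart_def std_coords_id std_coords_in_domain)

lemma line_coords_chart: "line_coords (chart c) = std_coords c"
  using std_coords_in_domain[of c] by (cases "std_coords c") (simp add: chart_def line_coords_hesse_line)

lemma chart_add_pi: "chart (p, \<phi> + pi) = chart (- p, \<phi>)"
  by (cases "p = 0") (simp_all add: chart_eq_hesse_line hesse_line_add_pi, simp add: chart_def std_coords_def)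

lemma chart_line_coords: "G \<in> lines_off_origin \<Longrightarrow> chart (line_coords G) = G"
  by (auto simp: lines_off_origin_eq line_coords_hesse_line chart_def std_coords_id)

section \<open>Euclidean motions acting on lines\<close>

definition motion :: "real \<Rightarrow> real \<times> real \<Rightarrow> plane \<Rightarrow> plane" where
  "motion \<alpha> b x = vector [x$1 * cos \<alpha> - x$2 * sin \<alpha> + fst b, x$1 * sin \<alpha> + x$2 * cos \<alpha> + snd b]"

text \<open>The orthogonality relations and \<open>det Q = 1\<close> force \<open>Q\<close> to have rows \<open>(c, - s)\<close> and \<open>(s, c)\<close> with
\<open>c\<^sup>2 + s\<^sup>2 = 1\<close>.\<close>

lemma euclidean_motion_iff: "euclidean_motion g \<longleftrightarrow> (\<exists>\<alpha> b. g = motion \<alpha> b)"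
proof
  assume "euclidean_motion g"
  then obtain Q b where Q: "orthogonal_matrix Q" "det Q = 1" and g: "g = (\<lambda>x. Q *v x + b)"
    by (auto simp: euclidean_motion_def rotation_matrix_def)
  have d: "Q$1$1 * Q$2$2 - Q$1$2 * Q$2$1 = 1" using Q by (simp add: det_2)
  have "transpose Q ** Q = mat 1" using Q by (simp add: orthogonal_matrix_def)
  then have "(transpose Q ** Q)$i$j = (mat 1 :: real^2^2)$i$j" for i j by simp
  from this[of 1 1] this[of 1 2] this[of 2 1] this[of 2 2]
  have o: "Q$1$1 * Q$1$1 + Q$2$1 * Q$2$1 = 1" "Q$1$1 * Q$1$2 + Q$2$1 * Q$2$2 = 0"
    "Q$1$2 * Q$1$2 + Q$2$2 * Q$2$2 = 1"
    by (simp_all add: matrix_matrix_mult_def transpose_def mat_def sum_2)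
  have e: "Q$2$2 = Q$1$1" "Q$1$2 = - Q$2$1"
    using d o by algebra+
  obtain t where t: "Q$1$1 = cos t" "Q$2$1 = sin t"
    using sincos_total_2pi_le[of "Q$1$1" "Q$2$1"] o by (auto simp: power2_eq_square)
  have "g = motion t (b$1, b$2)"
    by (rule ext) (simp add: g motion_def vec_eq_iff forall_2 matrix_vector_mult_def sum_2 e t algebra_simps)
  then show "\<exists>\<alpha> b. g = motion \<alpha> b" by blast
next
  assume "\<exists>\<alpha> b. g = motion \<alpha> b"
  then obtain \<alpha> b where g: "g = motion \<alpha> b" by blast
  define Q :: "real^2^2" where "Q = vector [vector [cos \<alpha>, - sin \<alpha>], vector [sin \<alpha>, cos \<alpha>]]"
  have "orthogonal_matrix Q"
    using sin_cos_squared_add[of \<alpha>]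
    by (simp add: orthogonal_matrix Q_def vec_eq_iff forall_2 matrix_matrix_mult_def transpose_def
        mat_def sum_2 power2_eq_square algebra_simps)
  moreover have "det Q = 1" using sin_cos_squared_add[of \<alpha>]
    by (simp add: Q_def det_2 power2_eq_square algebra_simps)
  moreover have "g = (\<lambda>x. Q *v x + vector [fst b, snd b])"
    by (rule ext) (simp add: g motion_def Q_def vec_eq_iff forall_2 matrix_vector_mult_def sum_2 algebra_simps)
  ultimately show "euclidean_motion g"
    unfolding euclidean_motion_def rotation_matrix_def by blast
qed

lemma motion_inverse:
  obtains b' where "\<And>x. motion (- \<alpha>) b' (motion \<alpha> b x) = x" "\<And>x. motion \<alpha> b (motion (- \<alpha>) b' x) = x"
proof
  fix x
  \<comment> \<open>The inverse of a rotation by \<open>\<alpha>\<close> followed by a translation by \<open>b\<close> translates by the image of \<open>- b\<close> under the rotation by \<open>- \<alpha>\<close>.\<close>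
  let ?b = "(- fst b * cos \<alpha> - snd b * sin \<alpha>, fst b * sin \<alpha> - snd b * cos \<alpha>)"
  have c: "cos \<alpha> * cos \<alpha> = 1 - sin \<alpha> * sin \<alpha>"
    using sin_cos_squared_add[of \<alpha>] by algebra
  show "motion (- \<alpha>) ?b (motion \<alpha> b x) = x"
    unfolding motion_def vec_eq_iff forall_2 using c by simp algebra
  show "motion \<alpha> b (motion (- \<alpha>) ?b x) = x"
    unfolding motion_def vec_eq_iff forall_2 using c by simp algebra
qed

text \<open>The action of \<open>motion \<alpha> b\<close> in redundant coordinates; see \<open>motion_hesse_line\<close>.\<close>

definition shift :: "real \<Rightarrow> real \<times> real \<Rightarrow> real \<times> real \<Rightarrow> real \<times> real" where
  "shift \<alpha> b = (\<lambda>(p, \<phi>). (p + fst b * cos (\<phi> + \<alpha>) + snd b * sin (\<phi> + \<alpha>), \<phi> + \<alpha>))"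

lemma motion_hesse_line: "motion \<alpha> b ` hesse_line p \<phi> = case_prod hesse_line (shift \<alpha> b (p, \<phi>))"
proof -
  obtain b' where b': "\<And>x. motion \<alpha> b (motion (- \<alpha>) b' x) = x"
    using motion_inverse by metis
  have *: "motion \<alpha> b x \<in> case_prod hesse_line (shift \<alpha> b (p, \<phi>)) \<longleftrightarrow> x \<in> hesse_line p \<phi>" for x
  proof -
    have "(x$1 * cos \<alpha> - x$2 * sin \<alpha>) * cos (\<phi> + \<alpha>) + (x$1 * sin \<alpha> + x$2 * cos \<alpha>) * sin (\<phi> + \<alpha>)
       = x$1 * cos \<phi> + x$2 * sin \<phi>"
      using sin_cos_squared_add[of \<alpha>] unfolding sin_add cos_add by algebra
    then show ?thesis
      by (auto simp: hesse_line_def motion_def shift_def algebra_simps)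
  qed
  show ?thesis
  proof (intro equalityI subsetI)
    fix y assume "y \<in> case_prod hesse_line (shift \<alpha> b (p, \<phi>))"
    then show "y \<in> motion \<alpha> b ` hesse_line p \<phi>"
      using *[of "motion (- \<alpha>) b' y"] b'[of y] by force
  qed (use * in \<open>auto simp only: image_iff\<close>)
qed

lemma line_angle_motion:
  assumes "G \<in> lines_off_origin" "0 \<notin> motion \<alpha> b ` G"
  shows "\<exists>k::int. snd (line_coords (motion \<alpha> b ` G)) = snd (line_coords G) + \<alpha> + pi * of_int k"
proof -
  obtain p \<phi> where G: "G = hesse_line p \<phi>" "(p, \<phi>) \<in> coord_domain"
    using assms(1) by (auto simp: lines_off_origin_eq)
  obtain p' where p': "motion \<alpha> b ` G = hesse_line p' (\<phi> + \<alpha>)"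
    by (simp add: G motion_hesse_line shift_def)
  with assms(2) have "p' \<noteq> 0" by (simp add: zero_in_hesse_line_iff)
  then show ?thesis
    using snd_line_coords_hesse_line[of p' "\<phi> + \<alpha>"] using G(2) by (simp add: p') (simp add: G(1) line_coords_hesse_line)
qed

section \<open>Null sets and periodic integrals\<close>

lemma AE_lborel_translate:
  assumes "AE x::real in lborel. P x"
  shows "AE x in lborel. P (t + x)"
proof (rule AE_distrD[where M' = borel and f = "(+) t"])
  show "AE x in distr lborel borel ((+) t). P x" using assms by (subst lborel_distr_plus)
qed simp

lemma nn_integral_translate:
  fixes f :: "real \<Rightarrow> ennreal"
  assumes "f \<in> borel_measurable borel"
  shows "(\<integral>\<^sup>+x. f (x + t) \<partial>lborel) = (\<integral>\<^sup>+x. f x \<partial>lborel)"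
  using nn_integral_real_affine[OF assms, of 1 t] by (simp add: add.commute)

lemma nn_integral_reflect:
  fixes f :: "real \<Rightarrow> ennreal"
  assumes "f \<in> borel_measurable borel"
  shows "(\<integral>\<^sup>+x. f (- x) \<partial>lborel) = (\<integral>\<^sup>+x. f x \<partial>lborel)"
  using nn_integral_real_affine[OF assms, of "- 1" 0] by simp

lemma periodic_int_multiple:
  fixes f :: "real \<Rightarrow> 'a"
  assumes "\<And>x. f (x + T) = f x"
  shows "f (x + T * of_int k) = f x"
proof -
  have *: "f (y + T * of_nat n) = f y" for y n
    by (induction n) (simp_all add: assms algebra_simps flip: add.assoc, metis add.commute add.left_commute assms)
  show ?thesis
    using *[of x "nat k"] *[of "x + T * of_int k" "nat (- k)"]
    by (cases "k \<ge> 0") simp_all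
qed

text \<open>It suffices to shift by \<open>r = a rmod T\<close>. The interval \<open>{r..<r+T}\<close> consists of \<open>{r..<T}\<close> and
\<open>{T..<T+r}\<close>, and by periodicity the second piece contributes the same as the missing \<open>{0..<r}\<close>.\<close>

lemma nn_integral_periodic_shift:
  fixes K :: "real \<Rightarrow> ennreal"
  assumes K [measurable]: "K \<in> borel_measurable borel" and "T > 0"
    and per: "\<And>x. K (x + T) = K x"
  shows "(\<integral>\<^sup>+x. K (x + a) * indicator {0..<T} x \<partial>lborel) = (\<integral>\<^sup>+x. K x * indicator {0..<T} x \<partial>lborel)"
proof -
  define r where "r = a rmod T"
  have r: "0 \<le> r" "r < T" using \<open>T > 0\<close> by (simp_all add: r_def rmod_nonneg rmod_less)
  have "a = r + T * of_int \<lfloor>a / T\<rfloor>" using \<open>T > 0\<close> by (simp add: r_def rmod_def)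
  then have "K (x + a) = K (x + r)" for x
    using periodic_int_multiple[of K T "x + r"] per by (metis add.assoc)
  then have "(\<integral>\<^sup>+x. K (x + a) * indicator {0..<T} x \<partial>lborel)
      = (\<integral>\<^sup>+x. K (x + r) * indicator {r..<r+T} (x + r) \<partial>lborel)"
    by (intro nn_integral_cong) (auto split: split_indicator)
  also have "\<dots> = (\<integral>\<^sup>+x. K x * indicator {r..<r+T} x \<partial>lborel)"
    by (subst nn_integral_translate[of "\<lambda>x. K x * indicator {r..<r+T} x"]) auto
  also have "\<dots> = (\<integral>\<^sup>+x. K x * indicator {r..<T} x + K x * indicator {T..<T+r} x \<partial>lborel)"
    using r by (intro nn_integral_cong) (auto split: split_indicator)
  also have "\<dots> = (\<integral>\<^sup>+x. K x * indicator {r..<T} x \<partial>lborel) + (\<integral>\<^sup>+x. K x * indicator {T..<T+r} x \<partial>lborel)"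
    by (intro nn_integral_add) auto
  also have "(\<integral>\<^sup>+x. K x * indicator {T..<T+r} x \<partial>lborel)
      = (\<integral>\<^sup>+x. K (x + T) * indicator {T..<T+r} (x + T) \<partial>lborel)"
    by (subst nn_integral_translate[of "\<lambda>x. K x * indicator {T..<T+r} x"]) auto
  also have "\<dots> = (\<integral>\<^sup>+x. K x * indicator {0..<r} x \<partial>lborel)"
    by (intro nn_integral_cong) (auto simp: per split: split_indicator)
  also have "(\<integral>\<^sup>+x. K x * indicator {r..<T} x \<partial>lborel) + \<dots>
      = (\<integral>\<^sup>+x. K x * indicator {r..<T} x + K x * indicator {0..<r} x \<partial>lborel)"
    by (intro nn_integral_add[symmetric]) auto
  also have "\<dots> = (\<integral>\<^sup>+x. K x * indicator {0..<T} x \<partial>lborel)"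
    using r by (intro nn_integral_cong) (auto split: split_indicator)
  finally show ?thesis .
qed

lemma AE_neq_0_and_neq_minus: "AE p in lborel. p \<noteq> (0::real) \<and> p + s \<noteq> 0"
proof -
  have "AE p in lborel. p \<noteq> 0 \<and> p \<noteq> - s"
    using AE_lborel_singleton[of "0::real"] AE_lborel_singleton[of "- s"] by (rule eventually_conj)
  then show ?thesis by (rule eventually_mono) auto
qed

lemma AE_pair_components:
  assumes "sigma_finite_measure M" "sigma_finite_measure N"
    and P: "AE x in M. P x" and Q: "AE y in N. Q y"
  shows "AE z in M \<Otimes>\<^sub>M N. P (fst z) \<and> Q (snd z)"
proof -
  interpret pair_sigma_finite M N using assms by (simp add: pair_sigma_finite_def)
  obtain A where A: "{x \<in> space M. \<not> P x} \<subseteq> A" "A \<in> null_sets M"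
    using P by (auto elim!: AE_E simp: null_sets_def)
  obtain B where B: "{y \<in> space N. \<not> Q y} \<subseteq> B" "B \<in> null_sets N"
    using Q by (auto elim!: AE_E simp: null_sets_def)
  have [measurable]: "A \<in> sets M" "B \<in> sets N" using A B by auto
  have "AE x in M. AE y in N. fst (x, y) \<notin> A \<and> snd (x, y) \<notin> B"
    by (rule eventually_mono[OF AE_not_in[OF A(2)]], rule eventually_mono[OF AE_not_in[OF B(2)]]) simp
  then have "AE z in M \<Otimes>\<^sub>M N. fst z \<notin> A \<and> snd z \<notin> B"
    by (intro AE_pair_measure) simp_all
  then show ?thesis
    using AE_space
  proof eventually_elim
    case (elim z)
    then show ?case using A(1) B(1) by (auto simp: space_pair_measure)
  qed
qed

text \<open>By Fubini, maps that pull null sets back to null sets have a product with the same property. This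
moves statements between pairs of lines and pairs of coordinates in both directions, although
\<open>chart\<close> is far from injective.\<close>

lemma AE_pair_nonsingular:
  assumes "sigma_finite_measure M" "sigma_finite_measure M'"
    and "sigma_finite_measure N" "sigma_finite_measure N'"
    and [measurable]: "f \<in> M \<rightarrow>\<^sub>M N" "g \<in> M' \<rightarrow>\<^sub>M N'"
    and f: "\<And>P. (AE y in N. P y) \<Longrightarrow> (AE x in M. P (f x))"
    and g: "\<And>P. (AE y in N'. P y) \<Longrightarrow> (AE x in M'. P (g x))"
    and P: "AE y in N \<Otimes>\<^sub>M N'. P y"
  shows "AE x in M \<Otimes>\<^sub>M M'. P (f (fst x), g (snd x))"
proof -
  interpret S: pair_sigma_finite M M' using assms by (simp add: pair_sigma_finite_def)
  interpret R: pair_sigma_finite N N' using assms by (simp add: pair_sigma_finite_def)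
  obtain Z where Z: "{y \<in> space (N \<Otimes>\<^sub>M N'). \<not> P y} \<subseteq> Z" "Z \<in> null_sets (N \<Otimes>\<^sub>M N')"
    using P by (auto elim!: AE_E simp: null_sets_def)
  have [measurable]: "Z \<in> sets (N \<Otimes>\<^sub>M N')" using Z by auto
  have "AE y in N. AE y' in N'. (y, y') \<notin> Z"
    using R.AE_pair[OF AE_not_in[OF Z(2)]] .
  then have "AE x in M. AE y' in N'. (f x, y') \<notin> Z" by (rule f)
  then have "AE x in M. AE x' in M'. (f x, g x') \<notin> Z"
    by (rule eventually_mono) (rule g)
  then have "AE x in M \<Otimes>\<^sub>M M'. (f (fst x), g (snd x)) \<notin> Z"
    by (intro S.AE_pair_measure) simp_all
  then show ?thesis
    using AE_space
  proof eventually_elim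
    case (elim x)
    then have "(f (fst x), g (snd x)) \<in> space (N \<Otimes>\<^sub>M N')"
      using measurable_space[OF assms(5)] measurable_space[OF assms(6)]
      by (auto simp: space_pair_measure)
    with elim Z(1) show ?case by auto
  qed
qed

text \<open>Differentiable maps into a space of at least the same dimension send null sets to null sets, so what
holds almost everywhere along \<open>T\<close> holds almost everywhere on its range.\<close>

lemma AE_lborel_image:
  fixes T :: "'a::euclidean_space \<Rightarrow> 'b::euclidean_space"
  assumes "DIM('a) \<le> DIM('b)" "T differentiable_on UNIV"
    and "AE x in lborel. Q (T x)"
  shows "AE y in lborel. y \<in> range T \<longrightarrow> Q y"
proof -
  obtain N where N: "{x \<in> space lborel. \<not> Q (T x)} \<subseteq> N" "N \<in> null_sets lborel"
    using assms(3) by (auto elim!: AE_E simp: null_sets_def)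
  have "negligible N"
    using N(2) by (simp add: negligible_iff_null_sets null_sets_completionI)
  then have "negligible (T ` N)"
    using assms by (intro negligible_differentiable_image_negligible) (auto intro: differentiable_on_subset)
  then obtain N' where N': "N' \<in> null_sets lborel" "T ` N \<subseteq> N'"
    by (auto simp: negligible_iff_null_sets null_sets_completion_iff2)
  have "AE y in lborel. y \<notin> N'" using N'(1) by (rule AE_not_in)
  then show ?thesis
    by (rule eventually_mono) (use N(1) N'(2) in auto)
qed

text \<open>Only sets on which \<open>f\<close> is integrable may be tested, and \<open>h\<close> is not known to be integrable anywhere in
advance. Sets of finite measure on which \<open>f\<close> is bounded and \<open>h - f\<close> has constant sign suffice: there
the difference has integral \<open>0\<close>, and countably many of them cover the space.\<close>

lemma AE_eq_of_set_integrals_eq: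
  fixes f h :: "'a \<Rightarrow> real"
  assumes "sigma_finite_measure M"
    and [measurable]: "f \<in> borel_measurable M" "h \<in> borel_measurable M"
    and int: "\<And>A. A \<in> sets M \<Longrightarrow> set_integrable M A f \<Longrightarrow>
      set_integrable M A h \<and> set_lebesgue_integral M A h = set_lebesgue_integral M A f"
  shows "AE x in M. h x = f x"
proof -
  interpret sigma_finite_measure M by fact
  obtain S :: "nat \<Rightarrow> 'a set" where S: "range S \<subseteq> sets M" "(\<Union>i. S i) = space M" "\<And>i. emeasure M (S i) \<noteq> \<infinity>"
    using sigma_finite by metis
  have [measurable]: "S i \<in> sets M" for i using S(1) by auto
  have one: "AE x in M. x \<in> A \<longrightarrow> h x = f x"
    if A [measurable]: "A \<in> sets M" and "emeasure M A \<noteq> \<infinity>" and bd: "\<And>x. x \<in> A \<Longrightarrow> \<bar>f x\<bar> \<le> real n"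
      and sgn: "s \<noteq> 0" "\<And>x. x \<in> A \<Longrightarrow> s * (h x - f x) \<ge> 0" for A n and s :: real
  proof -
    have f: "set_integrable M A f"
      unfolding set_integrable_def using that
      by (intro integrableI_bounded_set_indicator[where B = "real n"]) (auto simp: less_top)
    then have h: "set_integrable M A h" and eq: "set_lebesgue_integral M A h = set_lebesgue_integral M A f"
      using int[OF A] by auto
    have "integrable M (\<lambda>x. s * (indicator A x * h x - indicator A x * f x))"
      using f h unfolding set_integrable_def by simp
    moreover have "(\<integral>x. s * (indicator A x * h x - indicator A x * f x) \<partial>M) = 0"
      using f h eq unfolding set_integrable_def set_lebesgue_integral_def by simp
    moreover have "AE x in M. 0 \<le> s * (indicator A x * h x - indicator A x * f x)"
      using sgn by (auto split: split_indicator)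
    ultimately have "AE x in M. s * (indicator A x * h x - indicator A x * f x) = 0"
      using integral_nonneg_eq_0_iff_AE by blast
    then show ?thesis using sgn(1) by (auto elim!: eventually_mono split: split_indicator_asm)
  qed
  have "AE x in M. \<forall>i n::nat. x \<in> S i \<longrightarrow> \<bar>f x\<bar> \<le> real n \<longrightarrow> h x = f x"
    unfolding AE_all_countable
  proof (intro allI)
    fix i n :: nat
    \<comment> \<open>\<open>?A\<close> and \<open>?B\<close> are the parts on which the sign of \<open>h - f\<close> is constant.\<close>
    let ?A = "{x \<in> space M. x \<in> S i \<and> \<bar>f x\<bar> \<le> real n \<and> h x \<ge> f x}"
    let ?B = "{x \<in> space M. x \<in> S i \<and> \<bar>f x\<bar> \<le> real n \<and> h x \<le> f x}"
    have m: "?A \<in> sets M" "?B \<in> sets M" by measurable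
    have fin: "emeasure M ?A \<noteq> \<infinity>" "emeasure M ?B \<noteq> \<infinity>"
    proof -
      have "emeasure M ?A \<le> emeasure M (S i)" "emeasure M ?B \<le> emeasure M (S i)"
        by (intro emeasure_mono; auto)+
      then show "emeasure M ?A \<noteq> \<infinity>" "emeasure M ?B \<noteq> \<infinity>"
        using S(3)[of i] by (auto simp: top_unique)
    qed
    have "AE x in M. x \<in> ?A \<longrightarrow> h x = f x"
      by (rule one[where n = n and s = 1]) (use m fin in auto)
    moreover have "AE x in M. x \<in> ?B \<longrightarrow> h x = f x"
      by (rule one[where n = n and s = "- 1"]) (use m fin in auto)
    ultimately show "AE x in M. x \<in> S i \<longrightarrow> \<bar>f x\<bar> \<le> real n \<longrightarrow> h x = f x"
      using AE_space by eventually_elim auto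
  qed
  then show ?thesis using AE_space
  proof eventually_elim
    case (elim x)
    obtain i where "x \<in> S i" using elim S(2) by blast
    moreover obtain n :: nat where "\<bar>f x\<bar> \<le> real n" using real_arch_simple by blast
    ultimately show ?case using elim by blast
  qed
qed

lemma AE_sin_neq_0: "AE \<delta> in lborel. sin \<delta> \<noteq> (0::real)"
proof -
  have "AE \<delta> in lborel. \<forall>i::int. \<delta> \<noteq> of_int i * pi"
    unfolding AE_all_countable by (intro allI AE_lborel_singleton)
  then show ?thesis by (rule eventually_mono) (auto simp: sin_zero_iff_int2)
qed

section \<open>The measure on lines and its invariance\<close>

abbreviation coord_measure :: "(real \<times> real) measure" where
  "coord_measure \<equiv> restrict_space lborel coord_domain"

lemma coord_domain_borel [measurable]: "coord_domain \<in> sets borel"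
  unfolding coord_domain_def by (intro borel_Times) auto

lemma space_coord_measure: "space coord_measure = coord_domain"
  by (simp add: space_restrict_space)

lemma inj_on_chart: "inj_on chart coord_domain"
  by (rule inj_onI) (metis line_coords_chart std_coords_id)

text \<open>On \<open>coord_domain\<close> the chart inverts the coordinate map, so the line measure is the image of Lebesgue
measure under an explicit map.\<close>

lemma line_measure_eq: "line_measure = embed_measure coord_measure chart"
proof -
  have eq: "the_inv_into lines_off_origin line_coords c = chart c" if "c \<in> coord_domain" for c
    using that by (simp add: the_inv_into_line_coords chart_def std_coords_id)
  have im: "the_inv_into lines_off_origin line_coords ` A = chart ` A" if "A \<in> sets coord_measure" for A
    using sets.sets_into_space[OF that] eq by (intro image_cong) (auto simp: space_coord_measure)
  have pre: "the_inv_into lines_off_origin line_coords -` A \<inter> space coord_measure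
      = chart -` A \<inter> space coord_measure" for A
    using eq by (auto simp: space_coord_measure)
  have "{the_inv_into lines_off_origin line_coords ` A |A. A \<in> sets coord_measure}
      = {chart ` A |A. A \<in> sets coord_measure}"
    using im by blast
  then show ?thesis
    unfolding line_measure_def embed_measure_def by (simp only: pre im[OF sets.top])
qed

lemma space_line_measure: "space line_measure = lines_off_origin"
proof -
  have "chart ` coord_domain = case_prod hesse_line ` coord_domain"
    by (intro image_cong) (auto simp: chart_def std_coords_id)
  then show ?thesis
    by (simp add: line_measure_eq space_embed_measure space_coord_measure lines_off_origin_eq)
qed

lemma measurable_rmod [measurable]: "(\<lambda>x::real. x rmod y) \<in> borel_measurable borel"
  unfolding rmod_def by measurable

lemma measurable_std_coords [measurable]: "std_coords \<in> borel \<rightarrow>\<^sub>M coord_measure"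
proof (rule measurable_restrict_space2)
  show "std_coords \<in> borel \<rightarrow>\<^sub>M lborel"
    unfolding std_coords_def case_prod_beta borel_prod[symmetric] by measurable
qed (simp add: std_coords_in_domain)

lemma measurable_chart [measurable]: "chart \<in> borel \<rightarrow>\<^sub>M line_measure"
proof -
  have "chart \<in> coord_measure \<rightarrow>\<^sub>M line_measure"
    unfolding line_measure_eq
    by (rule measurable_embed_measure2') (simp add: space_coord_measure inj_on_chart)
  then have "(\<lambda>c. chart (std_coords c)) \<in> borel \<rightarrow>\<^sub>M line_measure" by measurable
  then show ?thesis by (simp add: chart_std_coords)
qed

lemma measurable_line_measureI:
  assumes "(\<lambda>c. h (chart c)) \<in> borel \<rightarrow>\<^sub>M N"
  shows "h \<in> line_measure \<rightarrow>\<^sub>M N"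
  unfolding line_measure_eq
  using assms by (intro measurable_embed_measure1 measurable_restrict_space1) simp

lemma measurable_line_coords: "line_coords \<in> line_measure \<rightarrow>\<^sub>M coord_measure"
  by (rule measurable_line_measureI) (simp add: line_coords_chart)

lemma measurable_line_coords_borel: "line_coords \<in> line_measure \<rightarrow>\<^sub>M borel"
  using measurable_line_coords by (simp add: measurable_restrict_space2_iff)

lemma distr_line_coords: "distr line_measure coord_measure line_coords = coord_measure"
proof -
  have "line_measure = distr coord_measure line_measure chart"
    using embed_measure_eq_distr'[of chart coord_measure]
    by (simp add: space_coord_measure inj_on_chart flip: line_measure_eq)
  then have "distr line_measure coord_measure line_coords
      = distr (distr coord_measure line_measure chart) coord_measure line_coords" by simp
  also have "\<dots> = distr coord_measure coord_measure (line_coords \<circ> chart)"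
    using measurable_line_coords by (intro distr_distr measurable_restrict_space1) auto
  also have "\<dots> = distr coord_measure coord_measure (\<lambda>c. c)"
    by (intro distr_cong) (auto simp: space_coord_measure line_coords_chart std_coords_id)
  finally show ?thesis by (simp add: distr_id)
qed

text \<open>Inherited from Lebesgue measure, of which the line measure becomes a restriction under the coordinate map.\<close>

lemma sigma_finite_line_measure: "sigma_finite_measure line_measure"
  by (rule sigma_finite_measure_distr[OF _ measurable_line_coords])
     (simp add: distr_line_coords sigma_finite_measure_restrict_space lborel.sigma_finite_measure_axioms)

lemma AE_line_coords:
  assumes "AE c in lborel. P c"
  shows "AE G in line_measure. P (line_coords G)"
proof (rule AE_distrD[OF measurable_line_coords])
  show "AE c in distr line_measure coord_measure line_coords. P c"
    unfolding distr_line_coords using assms by (subst AE_restrict_space_iff) auto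
qed

text \<open>Using signed distances, all directions are covered by a half turn: the lines with angle in
\<open>{pi..<2 * pi}\<close> and \<open>p > 0\<close> are those with angle in \<open>{0..<pi}\<close> and \<open>p < 0\<close>. The inner integral over all
\<open>p\<close> is then \<open>\<pi>\<close>-periodic in \<open>\<phi>\<close>, and translations of \<open>p\<close> leave it unchanged.\<close>

lemma nn_integral_line_measure:
  assumes h [measurable]: "h \<in> borel_measurable line_measure"
  shows "(\<integral>\<^sup>+G. h G \<partial>line_measure)
    = (\<integral>\<^sup>+\<phi>. (\<integral>\<^sup>+p. h (chart (p, \<phi>)) \<partial>lborel) * indicator {0..<pi} \<phi> \<partial>lborel)"
proof -
  define H where "H = (\<lambda>c. h (chart c))"
  have H [measurable]: "H \<in> borel_measurable borel" unfolding H_def by measurable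
  have Hpi: "H (p, \<phi> + pi) = H (- p, \<phi>)" for p \<phi> by (simp add: H_def chart_add_pi)
  define K where "K = (\<lambda>\<phi>. \<integral>\<^sup>+p. H (p, \<phi>) * indicator {0<..} p \<partial>lborel)"
  have [measurable]: "H \<in> borel_measurable (borel \<Otimes>\<^sub>M borel)" by (simp add: borel_prod)
  have K [measurable]: "K \<in> borel_measurable borel" unfolding K_def by measurable
  \<comment> \<open>\<open>K \<phi>\<close> integrates over the lines with \<open>p > 0\<close>, and \<open>K (\<phi> + pi)\<close> over those with angle \<open>\<phi>\<close> and \<open>p < 0\<close>.\<close>
  have K_sum: "K \<phi> + K (\<phi> + pi) = (\<integral>\<^sup>+p. H (p, \<phi>) \<partial>lborel)" for \<phi>
  proof -
    have "K (\<phi> + pi) = (\<integral>\<^sup>+p. H (- p, \<phi>) * indicator {..<0} (- p) \<partial>lborel)"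
      unfolding K_def by (intro nn_integral_cong) (auto simp: Hpi split: split_indicator)
    also have "\<dots> = (\<integral>\<^sup>+p. H (p, \<phi>) * indicator {..<0} p \<partial>lborel)"
      by (rule nn_integral_reflect[of "\<lambda>p. H (p, \<phi>) * indicator {..<0} p"]) measurable
    finally have "K \<phi> + K (\<phi> + pi)
        = (\<integral>\<^sup>+p. H (p, \<phi>) * indicator {0<..} p + H (p, \<phi>) * indicator {..<0} p \<partial>lborel)"
      unfolding K_def by (subst nn_integral_add) auto
    also have "\<dots> = (\<integral>\<^sup>+p. H (p, \<phi>) \<partial>lborel)"
      using AE_lborel_singleton[of "0::real"]
      by (intro nn_integral_cong_AE) (auto elim!: eventually_mono split: split_indicator)
    finally show ?thesis .
  qed
  have "(\<integral>\<^sup>+G. h G \<partial>line_measure) = (\<integral>\<^sup>+c. H c \<partial>coord_measure)"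
    unfolding H_def using h
    by (simp add: line_measure_eq nn_integral_embed_measure' space_coord_measure inj_on_chart)
  also have "\<dots> = (\<integral>\<^sup>+c. H c * indicator coord_domain c \<partial>lborel)"
    by (simp add: nn_integral_restrict_space)
  also have "\<dots> = (\<integral>\<^sup>+\<phi>. (\<integral>\<^sup>+p. H (p, \<phi>) * indicator coord_domain (p, \<phi>) \<partial>lborel) \<partial>lborel)"
    by (subst lborel_pair.nn_integral_snd) (simp_all add: lborel_prod)
  also have "\<dots> = (\<integral>\<^sup>+\<phi>. K \<phi> * indicator {0..<2*pi} \<phi> \<partial>lborel)"
    unfolding K_def
    by (subst nn_integral_multc[symmetric])
       (auto intro!: nn_integral_cong simp: coord_domain_def split: split_indicator)
  also have "\<dots> = (\<integral>\<^sup>+\<phi>. K \<phi> * indicator {0..<pi} \<phi> + K \<phi> * indicator {pi..<2*pi} \<phi> \<partial>lborel)"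
    by (intro nn_integral_cong) (auto split: split_indicator)
  also have "\<dots> = (\<integral>\<^sup>+\<phi>. K \<phi> * indicator {0..<pi} \<phi> \<partial>lborel)
      + (\<integral>\<^sup>+\<phi>. K \<phi> * indicator {pi..<2*pi} \<phi> \<partial>lborel)"
    by (intro nn_integral_add) auto
  also have "(\<integral>\<^sup>+\<phi>. K \<phi> * indicator {pi..<2*pi} \<phi> \<partial>lborel)
      = (\<integral>\<^sup>+\<phi>. K (\<phi> + pi) * indicator {pi..<2*pi} (\<phi> + pi) \<partial>lborel)"
    by (subst nn_integral_translate[of "\<lambda>\<phi>. K \<phi> * indicator {pi..<2*pi} \<phi>"]) auto
  also have "(\<integral>\<^sup>+\<phi>. K \<phi> * indicator {0..<pi} \<phi> \<partial>lborel) + \<dots>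
     = (\<integral>\<^sup>+\<phi>. K \<phi> * indicator {0..<pi} \<phi> + K (\<phi> + pi) * indicator {pi..<2*pi} (\<phi> + pi) \<partial>lborel)"
    by (intro nn_integral_add[symmetric]) auto
  also have "\<dots> = (\<integral>\<^sup>+\<phi>. (\<integral>\<^sup>+p. H (p, \<phi>) \<partial>lborel) * indicator {0..<pi} \<phi> \<partial>lborel)"
    unfolding K_sum[symmetric] by (intro nn_integral_cong) (auto split: split_indicator)
  finally show ?thesis by (simp add: H_def)
qed

text \<open>The integral formula only controls angles in one period. Periodicity of the inner integral
extends this to all angles, which are countably many translates of that period.\<close>

lemma AE_chart:
  assumes "AE G in line_measure. P G"
  shows "AE c in lborel. P (chart c)"
proof -
  from assms obtain N where N: "{G \<in> space line_measure. \<not> P G} \<subseteq> N" "N \<in> null_sets line_measure"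
    by (auto elim!: AE_E simp: null_sets_def)
  then have N_sets [measurable]: "N \<in> sets line_measure" by blast
  define K where "K = (\<lambda>\<phi>. \<integral>\<^sup>+p. indicator N (chart (p, \<phi>)) \<partial>lborel)"
  have [measurable]: "chart \<in> borel \<Otimes>\<^sub>M borel \<rightarrow>\<^sub>M line_measure" by (simp add: borel_prod)
  have K [measurable]: "K \<in> borel_measurable borel" unfolding K_def by measurable
  have "K (\<phi> + pi) = K \<phi>" for \<phi>
    unfolding K_def chart_add_pi by (rule nn_integral_reflect[of "\<lambda>p. indicator N (chart (p, \<phi>))"]) measurable
  then have per: "K (\<phi> + pi * of_int k) = K \<phi>" for \<phi> k
    using periodic_int_multiple[of K pi] by metis
  have "(\<integral>\<^sup>+G. indicator N G \<partial>line_measure) = 0" using null_setsD1[OF N(2)] by simp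
  then have "(\<integral>\<^sup>+\<phi>. K \<phi> * indicator {0..<pi} \<phi> \<partial>lborel) = 0"
    by (subst (asm) nn_integral_line_measure) (auto simp: K_def)
  then have "AE \<phi> in lborel. K \<phi> * indicator {0..<pi} \<phi> = 0"
    by (subst (asm) nn_integral_0_iff_AE) auto
  then have "AE \<phi> in lborel. K (pi * of_int k + \<phi>) * indicator {0..<pi} (pi * of_int k + \<phi>) = 0" for k
    by (rule AE_lborel_translate)
  then have "AE \<phi> in lborel. \<forall>k::int. K (pi * of_int k + \<phi>) * indicator {0..<pi} (pi * of_int k + \<phi>) = 0"
    by (simp add: AE_all_countable)
  moreover have "K \<phi> = 0" if "\<forall>k::int. K (pi * of_int k + \<phi>) * indicator {0..<pi} (pi * of_int k + \<phi>) = 0" for \<phi>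
  proof -
    have "pi * of_int (- \<lfloor>\<phi> / pi\<rfloor>) + \<phi> = \<phi> rmod pi" by (simp add: rmod_def)
    then have "pi * of_int (- \<lfloor>\<phi> / pi\<rfloor>) + \<phi> \<in> {0..<pi}" by (simp add: rmod_nonneg rmod_less)
    with that[rule_format, of "- \<lfloor>\<phi> / pi\<rfloor>"] show ?thesis
      using per[of \<phi> "- \<lfloor>\<phi> / pi\<rfloor>"] by (simp add: add.commute)
  qed
  ultimately have "AE \<phi> in lborel. K \<phi> = 0" by (auto elim: eventually_mono)
  then have "(\<integral>\<^sup>+\<phi>. K \<phi> \<partial>lborel) = 0" by (subst nn_integral_0_iff_AE) auto
  also have "(\<integral>\<^sup>+\<phi>. K \<phi> \<partial>lborel) = (\<integral>\<^sup>+c. indicator N (chart c) \<partial>lborel)"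
    unfolding K_def by (subst lborel_pair.nn_integral_snd[of "\<lambda>c. indicator N (chart c)", simplified]) (simp_all add: lborel_prod)
  finally have "AE c in lborel. (indicator N (chart c) :: ennreal) = 0"
    by (subst (asm) nn_integral_0_iff_AE) auto
  moreover have "chart c \<in> space line_measure" for c
    using measurable_space[OF measurable_chart, of c] by simp
  ultimately show ?thesis
    using N by (auto elim!: eventually_mono split: split_indicator_asm)
qed

text \<open>The action of a motion on the space of lines off the origin. A line that would be moved onto the origin
stays fixed; these lines form a null set (\<open>AE_off_origin\<close>).\<close>

definition move_line :: "(plane \<Rightarrow> plane) \<Rightarrow> plane set \<Rightarrow> plane set" where
  "move_line g G = (if 0 \<in> g ` G then G else g ` G)"

lemma motion_chart:
  assumes "fst c \<noteq> 0"
  shows "motion \<alpha> b ` chart c = case_prod hesse_line (shift \<alpha> b c)"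
  using assms by (cases c) (simp add: chart_eq_hesse_line motion_hesse_line)

lemma zero_in_motion_chart_iff:
  assumes "fst c \<noteq> 0"
  shows "0 \<in> motion \<alpha> b ` chart c \<longleftrightarrow> fst (shift \<alpha> b c) = 0"
  using assms by (simp add: motion_chart zero_in_hesse_line_iff split: prod.split)

lemma move_line_chart:
  assumes "fst c \<noteq> 0"
  shows "move_line (motion \<alpha> b) (chart c)
    = (if fst (shift \<alpha> b c) = 0 then chart c else chart (shift \<alpha> b c))"
proof (cases "fst (shift \<alpha> b c) = 0")
  case True
  then show ?thesis using zero_in_motion_chart_iff[OF assms] by (simp add: move_line_def)
next
  case False
  then have "move_line (motion \<alpha> b) (chart c) = motion \<alpha> b ` chart c"
    using zero_in_motion_chart_iff[OF assms] by (simp add: move_line_def)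
  with False assms show ?thesis by (simp add: motion_chart chart_eq_hesse_line[of "shift \<alpha> b c"])
qed

lemma measurable_shift [measurable]: "shift \<alpha> b \<in> borel \<rightarrow>\<^sub>M borel"
  unfolding shift_def case_prod_beta borel_prod[symmetric] by measurable

lemma measurable_std_coords_borel [measurable]: "std_coords \<in> borel \<rightarrow>\<^sub>M borel"
  by (rule measurable_restrict_space2_iff[THEN iffD1, THEN conjunct1, OF measurable_std_coords, simplified])

lemma measurable_fst_shift [measurable]: "(\<lambda>c. fst (shift \<alpha> b c)) \<in> borel \<rightarrow>\<^sub>M borel"
  unfolding shift_def case_prod_beta borel_prod[symmetric] by measurable

lemma measurable_move_line [measurable]: "move_line (motion \<alpha> b) \<in> line_measure \<rightarrow>\<^sub>M line_measure"
proof (rule measurable_line_measureI)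
  \<comment> \<open>Standard coordinates have \<open>p \<noteq> 0\<close>, so there the action on lines is given by \<open>shift\<close> for every \<open>c\<close>.\<close>
  have "(\<lambda>c. if fst (shift \<alpha> b (std_coords c)) = 0 then chart (std_coords c)
      else chart (shift \<alpha> b (std_coords c))) \<in> borel \<rightarrow>\<^sub>M line_measure"
    by measurable
  then show "(\<lambda>c. move_line (motion \<alpha> b) (chart c)) \<in> borel \<rightarrow>\<^sub>M line_measure"
    by (simp add: fst_std_coords_neq_0 chart_std_coords flip: move_line_chart)
qed

text \<open>For a fixed angle the motion translates \<open>p\<close>, which preserves the inner integral of
\<open>nn_integral_line_measure\<close>; the angle itself is shifted by \<open>\<alpha>\<close>, which preserves the integral of a
periodic function over a period.\<close>

lemma distr_move_line: "distr line_measure line_measure (move_line (motion \<alpha> b)) = line_measure"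
proof (rule measure_eqI)
  fix A assume "A \<in> sets (distr line_measure line_measure (move_line (motion \<alpha> b)))"
  then have A [measurable]: "A \<in> sets line_measure" by simp
  have [measurable]: "chart \<in> borel \<Otimes>\<^sub>M borel \<rightarrow>\<^sub>M line_measure" by (simp add: borel_prod)
  define K where "K = (\<lambda>\<phi>. \<integral>\<^sup>+p. indicator A (chart (p, \<phi>)) \<partial>lborel)"
  have K [measurable]: "K \<in> borel_measurable borel" unfolding K_def by measurable
  have per: "K (\<phi> + pi) = K \<phi>" for \<phi>
    unfolding K_def chart_add_pi by (rule nn_integral_reflect[of "\<lambda>p. indicator A (chart (p, \<phi>))"]) measurable
  have moved: "(\<integral>\<^sup>+p. indicator A (move_line (motion \<alpha> b) (chart (p, \<phi>))) \<partial>lborel) = K (\<phi> + \<alpha>)" for \<phi>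
  proof -
    define s where "s = fst b * cos (\<phi> + \<alpha>) + snd b * sin (\<phi> + \<alpha>)"
    have "(\<integral>\<^sup>+p. indicator A (move_line (motion \<alpha> b) (chart (p, \<phi>))) \<partial>lborel)
        = (\<integral>\<^sup>+p. indicator A (chart (p + s, \<phi> + \<alpha>)) \<partial>lborel)"
      by (intro nn_integral_cong_AE eventually_mono[OF AE_neq_0_and_neq_minus[of s]])
         (simp add: move_line_chart shift_def s_def add.assoc)
    also have "\<dots> = K (\<phi> + \<alpha>)"
      unfolding K_def by (rule nn_integral_translate[of "\<lambda>p. indicator A (chart (p, \<phi> + \<alpha>))"]) measurable
    finally show ?thesis .
  qed
  have "emeasure (distr line_measure line_measure (move_line (motion \<alpha> b))) A
      = (\<integral>\<^sup>+G. indicator A (move_line (motion \<alpha> b) G) \<partial>line_measure)"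
    by (subst nn_integral_indicator[symmetric], simp, subst nn_integral_distr) auto
  also have "\<dots> = (\<integral>\<^sup>+\<phi>. K (\<phi> + \<alpha>) * indicator {0..<pi} \<phi> \<partial>lborel)"
    by (subst nn_integral_line_measure) (simp_all add: moved)
  also have "\<dots> = (\<integral>\<^sup>+\<phi>. K \<phi> * indicator {0..<pi} \<phi> \<partial>lborel)"
    by (rule nn_integral_periodic_shift) (simp_all add: per)
  also have "\<dots> = (\<integral>\<^sup>+G. indicator A G \<partial>line_measure)"
    by (subst nn_integral_line_measure) (simp_all add: K_def)
  finally show "emeasure (distr line_measure line_measure (move_line (motion \<alpha> b))) A = emeasure line_measure A"
    by simp
qed simp

lemma pred_origin_in_motion [measurable]:
  "Measurable.pred line_measure (\<lambda>G. 0 \<in> motion \<alpha> b ` G)"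
proof (rule measurable_line_measureI)
  have "Measurable.pred borel (\<lambda>c. fst (shift \<alpha> b (std_coords c)) = 0)" by measurable
  then show "Measurable.pred borel (\<lambda>c. 0 \<in> motion \<alpha> b ` chart c)"
    by (simp add: fst_std_coords_neq_0 chart_std_coords flip: zero_in_motion_chart_iff)
qed

lemma AE_off_origin: "AE G in line_measure. 0 \<notin> motion \<alpha> b ` G"
proof -
  define Z where "Z = {G \<in> space line_measure. 0 \<in> motion \<alpha> b ` G}"
  have Z [measurable]: "Z \<in> sets line_measure" unfolding Z_def by measurable
  have "emeasure line_measure Z = (\<integral>\<^sup>+G. indicator Z G \<partial>line_measure)" by simp
  also have "\<dots> = (\<integral>\<^sup>+\<phi>. (\<integral>\<^sup>+p. indicator Z (chart (p, \<phi>)) \<partial>lborel) * indicator {0..<pi} \<phi> \<partial>lborel)"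
    by (rule nn_integral_line_measure) simp
  also have "\<dots> = 0"
  proof -
    have "(\<integral>\<^sup>+p. indicator Z (chart (p, \<phi>)) \<partial>lborel) = (\<integral>\<^sup>+p. 0 \<partial>(lborel :: real measure))" for \<phi>
    proof (intro nn_integral_cong_AE)
      show "AE p in lborel. indicator Z (chart (p, \<phi>)) = (0 :: ennreal)"
        using AE_neq_0_and_neq_minus[of "fst b * cos (\<phi> + \<alpha>) + snd b * sin (\<phi> + \<alpha>)"]
        by (rule eventually_mono) (simp add: Z_def zero_in_motion_chart_iff shift_def add.assoc)
    qed
    then show ?thesis by simp
  qed
  finally have "emeasure line_measure Z = 0" .
  then show ?thesis by (intro AE_I[of _ _ Z]) (auto simp: Z_def[symmetric] simp flip: Z_def)
qed

section \<open>Invariance of a density on pairs of lines\<close>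

abbreviation move_line_pair :: "(plane \<Rightarrow> plane) \<Rightarrow> plane set \<times> plane set \<Rightarrow> plane set \<times> plane set" where
  "move_line_pair g \<equiv> (\<lambda>(G, G'). (move_line g G, move_line g G'))"

lemma distr_move_line_pair:
  "distr line_pair_measure line_pair_measure (move_line_pair (motion \<alpha> b)) = line_pair_measure"
  unfolding line_pair_measure_def
  by (subst pair_measure_distr[symmetric]) (simp_all add: distr_move_line sigma_finite_line_measure)

lemma measurable_move_line_pair [measurable]:
  "move_line_pair (motion \<alpha> b) \<in> line_pair_measure \<rightarrow>\<^sub>M line_pair_measure"
  unfolding line_pair_measure_def by measurable

lemma sigma_finite_line_pair_measure: "sigma_finite_measure line_pair_measure"
  unfolding line_pair_measure_def
  by (simp add: sigma_finite_pair_measure sigma_finite_line_measure)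

lemma space_line_pair_measure: "space line_pair_measure = lines_off_origin \<times> lines_off_origin"
  by (simp add: line_pair_measure_def space_pair_measure space_line_measure)

lemma AE_pair_off_origin:
  "AE x in line_pair_measure. 0 \<notin> motion \<alpha> b ` fst x \<and> 0 \<notin> motion \<alpha> b ` snd x"
  unfolding line_pair_measure_def
  by (intro AE_pair_components sigma_finite_line_measure AE_off_origin)

text \<open>The pairs of lines meeting the disc of radius \<open>n\<close> exhaust the space as \<open>n\<close> grows, so \<open>F\<close> is a pointwise
limit of integrable functions.\<close>

lemma measurable_if_locally_integrable:
  assumes "locally_integrable_pairs F"
  shows "F \<in> borel_measurable line_pair_measure"
proof -
  define B :: "nat \<Rightarrow> (plane set \<times> plane set) set" where
    "B n = {(G, G'). G \<inter> cball 0 (real n) \<noteq> {} \<and> G' \<inter> cball 0 (real n) \<noteq> {}}" for n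
  show ?thesis
  proof (rule borel_measurable_LIMSEQ_real)
    show "(\<lambda>x. indicator (B n) x *\<^sub>R F x) \<in> borel_measurable line_pair_measure" for n
      using assms unfolding locally_integrable_pairs_def set_integrable_def B_def
      by (blast intro: borel_measurable_integrable)
    fix x assume "x \<in> space line_pair_measure"
    then obtain G G' where x: "x = (G, G')" "G \<noteq> {}" "G' \<noteq> {}"
      by (force simp: space_line_pair_measure lines_off_origin_def)
    then obtain y y' where y: "y \<in> G" "y' \<in> G'" by blast
    obtain m :: nat where m: "max (norm y) (norm y') \<le> real m" using real_arch_simple by blast
    have "\<forall>\<^sub>F n in sequentially. indicator (B n) x *\<^sub>R F x = F x"
      using eventually_ge_at_top[of m]
    proof eventually_elim
      case (elim n)
      then have "y \<in> G \<inter> cball 0 (real n)" "y' \<in> G' \<inter> cball 0 (real n)"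
        using m y by auto
      then have "x \<in> B n" by (auto simp: B_def x)
      then show ?case by simp
    qed
    then show "(\<lambda>n. indicator (B n) x *\<^sub>R F x) \<longlonglongrightarrow> F x"
      by (rule tendsto_eventually)
  qed
qed

text \<open>Off the exceptional null sets, \<open>move_pairs g A\<close> is the preimage of \<open>A\<close> under the inverse motion.\<close>

lemma move_pairs_measurable:
  fixes \<alpha> b
  defines "g \<equiv> motion \<alpha> b"
  assumes [measurable]: "A \<in> sets line_pair_measure"
  shows "move_pairs g A \<inter> space line_pair_measure \<in> sets line_pair_measure"
    and "\<And>x. x \<in> space line_pair_measure \<Longrightarrow> 0 \<notin> g ` fst x \<Longrightarrow> 0 \<notin> g ` snd x \<Longrightarrow>
      move_line_pair g x \<in> move_pairs g A \<longleftrightarrow> x \<in> A"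
proof -
  obtain b' where inv: "\<And>x. motion (- \<alpha>) b' (g x) = x" "\<And>x. g (motion (- \<alpha>) b' x) = x"
    unfolding g_def using motion_inverse by metis
  define g' where "g' = motion (- \<alpha>) b'"
  have inv_im: "g' ` g ` G = G" "g ` g' ` G = G" for G
    using inv by (auto simp: g'_def image_image)
  have A: "(G, G') \<in> A \<Longrightarrow> G \<in> lines_off_origin \<and> G' \<in> lines_off_origin" for G G'
    using sets.sets_into_space[OF assms(2)] by (auto simp: space_line_pair_measure)
  have "move_pairs g A \<inter> space line_pair_measure
     = {x \<in> space line_pair_measure. move_line_pair g' x \<in> A \<and> 0 \<notin> g' ` fst x \<and> 0 \<notin> g' ` snd x}"
    (is "?L = ?R")
  proof (intro equalityI subsetI)
    fix x assume x: "x \<in> ?L"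
    then obtain G G' where "x = (g ` G, g ` G')" "(G, G') \<in> A"
      by (auto simp: move_pairs_def)
    with x A[of G G'] show "x \<in> ?R"
      by (auto simp: inv_im move_line_def lines_off_origin_def)
  next
    fix x assume x: "x \<in> ?R"
    obtain G G' where G: "x = (G, G')" by force
    with x have "(g' ` G, g' ` G') \<in> A" by (auto simp: move_line_def)
    then have "(g ` g' ` G, g ` g' ` G') \<in> move_pairs g A" unfolding move_pairs_def by force
    with x G show "x \<in> ?L" by (simp add: inv_im)
  qed
  also have "\<dots> \<in> sets line_pair_measure"
  proof -
    have [measurable]: "move_line_pair g' \<in> line_pair_measure \<rightarrow>\<^sub>M line_pair_measure"
      unfolding g'_def by measurable
    have [measurable]: "Measurable.pred line_measure (\<lambda>G. 0 \<in> g' ` G)"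
      unfolding g'_def by (rule pred_origin_in_motion)
    have [measurable]: "fst \<in> line_pair_measure \<rightarrow>\<^sub>M line_measure" "snd \<in> line_pair_measure \<rightarrow>\<^sub>M line_measure"
      unfolding line_pair_measure_def by measurable
    show ?thesis by measurable
  qed
  finally show "move_pairs g A \<inter> space line_pair_measure \<in> sets line_pair_measure" .
  have inj: "g ` G = g ` K \<longleftrightarrow> G = K" for G K using inv_im by metis
  fix x assume "x \<in> space line_pair_measure" "0 \<notin> g ` fst x" "0 \<notin> g ` snd x"
  then show "move_line_pair g x \<in> move_pairs g A \<longleftrightarrow> x \<in> A"
    by (cases x) (auto simp: move_line_def move_pairs_def inj)
qed

text \<open>Change of variables by the measure-preserving map \<open>move_line_pair g\<close>.\<close>

lemma set_integral_move_pairs: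
  fixes F :: "plane set \<times> plane set \<Rightarrow> real" and \<alpha> b
  defines "g \<equiv> motion \<alpha> b"
  assumes F [measurable]: "F \<in> borel_measurable line_pair_measure" and A: "A \<in> sets line_pair_measure"
  shows "set_integrable line_pair_measure (move_pairs g A) F
      \<longleftrightarrow> set_integrable line_pair_measure A (\<lambda>x. F (move_line_pair g x))"
    and "set_lebesgue_integral line_pair_measure (move_pairs g A) F
      = set_lebesgue_integral line_pair_measure A (\<lambda>x. F (move_line_pair g x))"
proof -
  let ?M = line_pair_measure
  define B where "B = move_pairs g A \<inter> space ?M"
  have B [measurable]: "B \<in> sets ?M" unfolding B_def g_def by (rule move_pairs_measurable) fact
  note [measurable] = A
  have g [measurable]: "move_line_pair g \<in> ?M \<rightarrow>\<^sub>M ?M" unfolding g_def by measurable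
  have B_eq: "indicator (move_pairs g A) x *\<^sub>R F x = indicator B x *\<^sub>R F x" if "x \<in> space ?M" for x
    using that by (simp add: B_def indicator_def)
  have AE: "AE x in ?M. indicator B (move_line_pair g x) *\<^sub>R F (move_line_pair g x)
      = indicator A x *\<^sub>R F (move_line_pair g x)"
    using AE_pair_off_origin[of \<alpha> b] AE_space
  proof eventually_elim
    case (elim x)
    then have "move_line_pair g x \<in> B \<longleftrightarrow> x \<in> A"
      using move_pairs_measurable(2)[OF A, of x \<alpha> b] measurable_space[OF g, of x]
      by (auto simp: B_def g_def)
    then show ?case by (simp add: indicator_def)
  qed
  have "set_integrable ?M (move_pairs g A) F \<longleftrightarrow> integrable ?M (\<lambda>x. indicator B x *\<^sub>R F x)"
    unfolding set_integrable_def by (rule Bochner_Integration.integrable_cong) (use B_eq in auto)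
  also have "\<dots> \<longleftrightarrow> integrable (distr ?M ?M (move_line_pair g)) (\<lambda>x. indicator B x *\<^sub>R F x)"
    unfolding g_def distr_move_line_pair ..
  also have "\<dots> \<longleftrightarrow> integrable ?M (\<lambda>x. indicator B (move_line_pair g x) *\<^sub>R F (move_line_pair g x))"
    by (rule integrable_distr_eq) measurable
  also have "\<dots> \<longleftrightarrow> integrable ?M (\<lambda>x. indicator A x *\<^sub>R F (move_line_pair g x))"
    by (rule integrable_cong_AE[OF _ _ AE]) measurable
  finally show "set_integrable ?M (move_pairs g A) F
      \<longleftrightarrow> set_integrable ?M A (\<lambda>x. F (move_line_pair g x))"
    unfolding set_integrable_def .
  have "set_lebesgue_integral ?M (move_pairs g A) F = integral\<^sup>L ?M (\<lambda>x. indicator B x *\<^sub>R F x)"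
    unfolding set_lebesgue_integral_def by (rule Bochner_Integration.integral_cong) (use B_eq in auto)
  also have "\<dots> = integral\<^sup>L (distr ?M ?M (move_line_pair g)) (\<lambda>x. indicator B x *\<^sub>R F x)"
    unfolding g_def distr_move_line_pair ..
  also have "\<dots> = integral\<^sup>L ?M (\<lambda>x. indicator B (move_line_pair g x) *\<^sub>R F (move_line_pair g x))"
    by (rule integral_distr) measurable
  also have "\<dots> = integral\<^sup>L ?M (\<lambda>x. indicator A x *\<^sub>R F (move_line_pair g x))"
    by (rule integral_cong_AE[OF _ _ AE]) measurable
  finally show "set_lebesgue_integral ?M (move_pairs g A) F
      = set_lebesgue_integral ?M A (\<lambda>x. F (move_line_pair g x))"
    unfolding set_lebesgue_integral_def .
qed

text \<open>The integral of \<open>F\<close> over the moved set is the integral of \<open>F \<circ> g\<close> over the original one, so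
invariance says that \<open>F \<circ> g\<close> and \<open>F\<close> have the same integrals over all sets on which \<open>F\<close> is
integrable.\<close>

lemma motion_invariant_density_iff:
  assumes F [measurable]: "F \<in> borel_measurable line_pair_measure"
  shows "motion_invariant_density F \<longleftrightarrow>
    (\<forall>\<alpha> b. AE x in line_pair_measure. F (move_line_pair (motion \<alpha> b) x) = F x)"
proof (intro iffI allI)
  fix \<alpha> b
  assume inv: "motion_invariant_density F"
  have g: "euclidean_motion (motion \<alpha> b)" using euclidean_motion_iff by blast
  show "AE x in line_pair_measure. F (move_line_pair (motion \<alpha> b) x) = F x"
  proof (rule AE_eq_of_set_integrals_eq[OF sigma_finite_line_pair_measure F])
    fix A assume A: "A \<in> sets line_pair_measure" and int: "set_integrable line_pair_measure A F"
    show "set_integrable line_pair_measure A (\<lambda>x. F (move_line_pair (motion \<alpha> b) x)) \<and>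
        set_lebesgue_integral line_pair_measure A (\<lambda>x. F (move_line_pair (motion \<alpha> b) x))
          = set_lebesgue_integral line_pair_measure A F"
      using inv[unfolded motion_invariant_density_def, rule_format, OF g A int]
      unfolding set_integral_move_pairs[OF F A] .
  qed measurable
next
  assume *: "\<forall>\<alpha> b. AE x in line_pair_measure. F (move_line_pair (motion \<alpha> b) x) = F x"
  show "motion_invariant_density F"
    unfolding motion_invariant_density_def euclidean_motion_iff
  proof (intro allI impI, elim exE)
    fix g A \<alpha> b
    assume g: "g = motion \<alpha> b" and A [measurable]: "A \<in> sets line_pair_measure"
      and int: "set_integrable line_pair_measure A F"
    have AE: "AE x in line_pair_measure. F (move_line_pair g x) = F x" using * g by blast
    have [measurable]: "(\<lambda>x. F (move_line_pair g x)) \<in> borel_measurable line_pair_measure"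
      unfolding g by measurable
    have "set_integrable line_pair_measure A (\<lambda>x. F (move_line_pair g x))
        \<longleftrightarrow> set_integrable line_pair_measure A F"
      unfolding set_integrable_def using AE
      by (intro integrable_cong_AE) (auto elim: eventually_mono)
    moreover have "set_lebesgue_integral line_pair_measure A (\<lambda>x. F (move_line_pair g x))
        = set_lebesgue_integral line_pair_measure A F"
      unfolding set_lebesgue_integral_def using AE
      by (intro integral_cong_AE) (auto elim: eventually_mono)
    ultimately show "set_integrable line_pair_measure (move_pairs g A) F \<and>
        set_lebesgue_integral line_pair_measure (move_pairs g A) F = set_lebesgue_integral line_pair_measure A F"
      using int set_integral_move_pairs[OF F A, of \<alpha> b] unfolding g by simp
  qed
qed

section \<open>Functions on pairs of lines that are constant on orbits\<close>

lemma AE_chart_regular: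
  "AE c in lborel. fst c \<noteq> 0 \<and> fst (shift \<alpha> b c) \<noteq> 0"
proof -
  have "AE p in lborel. p \<noteq> (0::real)" by (rule AE_lborel_singleton)
  then have "AE c in lborel \<Otimes>\<^sub>M lborel. fst c \<noteq> (0::real) \<and> (\<lambda>_::real. True) (snd c)"
    by (intro AE_pair_components lborel.sigma_finite_measure_axioms) auto
  then have "AE c :: real \<times> real in lborel. fst c \<noteq> 0" unfolding lborel_prod by simp
  then show ?thesis
    using AE_chart[OF AE_off_origin[of \<alpha> b]]
    by eventually_elim (simp add: zero_in_motion_chart_iff)
qed

text \<open>A motion \<open>(b, \<alpha>)\<close> and a pair of redundant coordinates yield the point \<open>(\<delta>, z)\<close> that represents the
pair, followed by the point \<open>z'\<close> that represents the moved pair in the fibre over the same \<open>\<delta>\<close>. Points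
of a fibre are written as \<open>(\<phi>, p, q)\<close>.\<close>

definition transit ::
  "((real \<times> real) \<times> real) \<times> ((real \<times> real) \<times> real \<times> real) \<Rightarrow> (real \<times> real \<times> real \<times> real) \<times> (real \<times> real \<times> real)" where
  "transit = (\<lambda>((b, \<alpha>), ((p, \<phi>), (q, \<psi>))).
     ((\<psi> - \<phi>, \<phi>, p, q), (\<phi> + \<alpha>, fst (shift \<alpha> b (p, \<phi>)), fst (shift \<alpha> b (q, \<psi>)))))"

lemma transit_differentiable: "transit differentiable_on UNIV"
  unfolding transit_def shift_def differentiable_on_def differentiable_def case_prod_beta fst_conv snd_conv
  by (intro ballI exI) (rule derivative_intros)+

text \<open>The translation \<open>(b1, b2)\<close> is given by Cramer's rule for the two equations that fix the new distances
\<open>p'\<close> and \<open>q'\<close>; the determinant of the system is \<open>sin \<delta>\<close>.\<close>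

lemma in_range_transit:
  assumes "sin \<delta> \<noteq> 0"
  shows "((\<delta>, \<phi>, p, q), (\<phi>', p', q')) \<in> range transit"
proof -
  define b1 where "b1 = ((p' - p) * sin (\<phi>' + \<delta>) - (q' - q) * sin \<phi>') / sin \<delta>"
  define b2 where "b2 = ((q' - q) * cos \<phi>' - (p' - p) * cos (\<phi>' + \<delta>)) / sin \<delta>"
  have "sin \<delta> = cos \<phi>' * sin (\<phi>' + \<delta>) - cos (\<phi>' + \<delta>) * sin \<phi>'"
    using sin_diff[of "\<phi>' + \<delta>" \<phi>'] by (simp add: mult.commute)
  moreover have "b1 * sin \<delta> = (p' - p) * sin (\<phi>' + \<delta>) - (q' - q) * sin \<phi>'"
    "b2 * sin \<delta> = (q' - q) * cos \<phi>' - (p' - p) * cos (\<phi>' + \<delta>)"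
    using assms by (simp_all add: b1_def b2_def)
  ultimately have "sin \<delta> * (b1 * cos \<phi>' + b2 * sin \<phi>') = sin \<delta> * (p' - p)"
    "sin \<delta> * (b1 * cos (\<phi>' + \<delta>) + b2 * sin (\<phi>' + \<delta>)) = sin \<delta> * (q' - q)"
    by algebra+
  with assms have "b1 * cos \<phi>' + b2 * sin \<phi>' = p' - p"
    "b1 * cos (\<phi>' + \<delta>) + b2 * sin (\<phi>' + \<delta>) = q' - q"
    by simp_all
  then have "transit (((b1, b2), \<phi>' - \<phi>), ((p, \<phi>), (q, \<phi> + \<delta>))) = ((\<delta>, \<phi>, p, q), (\<phi>', p', q'))"
    by (simp add: transit_def shift_def algebra_simps)
  then show ?thesis by (metis rangeI)
qed

text \<open>Here \<open>E \<delta>\<close> is \<open>H\<close> restricted to the fibre over \<open>\<delta>\<close>, and \<open>f \<delta>\<close> is the constant to which it is almost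
everywhere equal, chosen by \<open>SOME\<close>. The choice depends only on the predicate defining it, and this
predicate is the same for \<open>\<delta> + pi\<close> and \<open>\<delta>\<close>; hence \<open>f\<close> is periodic even at angles whose fibre admits no
such constant. As \<open>f\<close> may fail to be measurable, Fubini is applied to the comparison of
\<open>E \<delta> z\<close> with almost all \<open>E \<delta> z'\<close> instead, which gives the value of \<open>E \<delta> z\<close> for almost all \<open>(\<delta>, z)\<close>.\<close>

lemma shift_invariant_imp_angle_function:
  fixes H :: "(real \<times> real) \<times> (real \<times> real) \<Rightarrow> real"
  assumes H [measurable]: "H \<in> borel_measurable borel"
    and sym: "\<And>c q \<psi>. H (c, (q, \<psi> + pi)) = H (c, (- q, \<psi>))"
    and inv: "\<And>\<alpha> b. AE x in lborel. H (shift \<alpha> b (fst x), shift \<alpha> b (snd x)) = H x"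
  shows "\<exists>f. (\<forall>t. f (t + pi) = f t) \<and> (AE x in lborel. H x = f (snd (snd x) - snd (fst x)))"
proof -
  define E where "E = (\<lambda>\<delta> (\<phi>, p, q). H ((p, \<phi>), (q, \<phi> + \<delta>)))"
  define f where "f \<delta> = (SOME c. AE z in lborel. E \<delta> z = c)" for \<delta>
  have per: "f (\<delta> + pi) = f \<delta>" for \<delta>
  proof -
    define R :: "real \<times> real \<times> real \<Rightarrow> real \<times> real \<times> real" where "R = (\<lambda>(\<phi>, p, q). (\<phi>, p, - q))"
    have R: "R differentiable_on UNIV"
      unfolding R_def differentiable_on_def differentiable_def case_prod_beta
      by (intro ballI exI) (rule derivative_intros)+
    have RR: "R (R z) = z" for z by (simp add: R_def split: prod.splits)
    then have "z \<in> range R" for z by (metis rangeI)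
    then have AE_R: "AE z in lborel. P z" if "AE z in lborel. P (R z)" for P
      using AE_lborel_image[OF _ R that] by simp
    have E_R: "E (\<delta> + pi) z = E \<delta> (R z)" for z
      using sym by (simp add: E_def R_def flip: add.assoc split: prod.splits)
    have "(AE z in lborel. E (\<delta> + pi) z = c) \<longleftrightarrow> (AE z in lborel. E \<delta> z = c)" for c
      unfolding E_R using AE_R[of "\<lambda>z. E \<delta> z = c"] AE_R[of "\<lambda>z. E \<delta> (R z) = c", unfolded RR]
      by (rule iffI)
    then show ?thesis by (simp add: f_def)
  qed
  \<comment> \<open>\<open>?S\<close> applies the motion in the first component to the pair in the second, so that Fubini gives invariance for almost all motions and pairs jointly.\<close>
  let ?S = "\<lambda>y :: ((real \<times> real) \<times> real) \<times> ((real \<times> real) \<times> real \<times> real).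
      (shift (snd (fst y)) (fst (fst y)) (fst (snd y)), shift (snd (fst y)) (fst (fst y)) (snd (snd y)))"
  have [measurable]: "?S \<in> borel \<rightarrow>\<^sub>M borel"
    unfolding shift_def case_prod_beta
    by (intro borel_measurable_continuous_onI continuous_intros)
  have [measurable]: "(snd :: ((real \<times> real) \<times> real) \<times> ((real \<times> real) \<times> real \<times> real) \<Rightarrow> _) \<in> borel \<rightarrow>\<^sub>M borel"
    by (intro borel_measurable_continuous_onI continuous_intros)
  have pred: "Measurable.pred borel (\<lambda>y. H (?S y) = H (snd y))"
    by measurable
  have "AE y in lborel \<Otimes>\<^sub>M lborel. H (?S y) = H (snd y)"
  proof (rule lborel_pair.AE_pair_measure)
    show "{y \<in> space (lborel \<Otimes>\<^sub>M lborel). H (?S y) = H (snd y)} \<in> sets (lborel \<Otimes>\<^sub>M lborel)"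
      unfolding lborel_prod using pred by (simp add: pred_def)
  qed (use inv in simp)
  then have "AE y in lborel. H (?S y) = H (snd y)" unfolding lborel_prod .
  then have "AE y in lborel. E (fst (fst (transit y))) (snd (fst (transit y))) = E (fst (fst (transit y))) (snd (transit y))"
    by (rule eventually_mono)
       (auto simp: transit_def E_def shift_def algebra_simps split: prod.splits)
  then have "AE w in lborel. w \<in> range transit \<longrightarrow> E (fst (fst w)) (snd (fst w)) = E (fst (fst w)) (snd w)"
    using AE_lborel_image[OF _ transit_differentiable,
      where Q = "\<lambda>w. E (fst (fst w)) (snd (fst w)) = E (fst (fst w)) (snd w)"] by simp
  moreover have "AE w :: (real \<times> real \<times> real \<times> real) \<times> (real \<times> real \<times> real) in lborel. sin (fst (fst w)) \<noteq> 0"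
  proof -
    have "AE y in lborel \<Otimes>\<^sub>M lborel. sin (fst y) \<noteq> (0::real) \<and> (\<lambda>_::real \<times> real \<times> real. True) (snd y)"
      by (intro AE_pair_components lborel.sigma_finite_measure_axioms AE_sin_neq_0) auto
    then have "AE y :: real \<times> real \<times> real \<times> real in lborel. sin (fst y) \<noteq> 0"
      unfolding lborel_prod by simp
    then have "AE w in lborel \<Otimes>\<^sub>M lborel. (sin (fst (fst w :: real \<times> real \<times> real \<times> real)) \<noteq> 0)
        \<and> (\<lambda>_::real \<times> real \<times> real. True) (snd w)"
      by (intro AE_pair_components lborel.sigma_finite_measure_axioms) auto
    then show ?thesis unfolding lborel_prod by simp
  qed
  ultimately have "AE w in lborel. E (fst (fst w)) (snd (fst w)) = E (fst (fst w)) (snd w)"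
    by eventually_elim (use in_range_transit in force)
  then have "AE w in lborel \<Otimes>\<^sub>M lborel. E (fst (fst w)) (snd (fst w)) = E (fst (fst w)) (snd w)"
    unfolding lborel_prod .
  then have "AE y in lborel. AE z' in lborel. E (fst y) (snd y) = E (fst y) z'"
    by (auto dest!: lborel_pair.AE_pair)
  then have "AE y in lborel. E (fst y) (snd y) = f (fst y)"
  proof (rule eventually_mono)
    fix y :: "real \<times> real \<times> real \<times> real"
    assume y: "AE z' in lborel. E (fst y) (snd y) = E (fst y) z'"
    then have "AE z' in lborel. E (fst y) z' = E (fst y) (snd y)" by (rule eventually_mono) simp
    then have "AE z' in lborel. E (fst y) z' = f (fst y)"
      unfolding f_def by (rule someI)
    with y have "AE z' in (lborel :: (real \<times> real \<times> real) measure). E (fst y) (snd y) = f (fst y)"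
      by eventually_elim simp
    moreover have "\<not> (AE z' in (lborel :: (real \<times> real \<times> real) measure). False)"
      using AE_iff_null_sets[of UNIV "lborel :: (real \<times> real \<times> real) measure"]
      by (simp add: null_sets_def emeasure_lborel_UNIV)
    ultimately show "E (fst y) (snd y) = f (fst y)" by (cases "E (fst y) (snd y) = f (fst y)") auto
  qed
  \<comment> \<open>The linear change of coordinates \<open>T\<close> returns from fibre coordinates to pairs of coordinates.\<close>
  moreover define T :: "real \<times> real \<times> real \<times> real \<Rightarrow> (real \<times> real) \<times> real \<times> real" where
    "T = (\<lambda>(\<delta>, \<phi>, p, q). ((p, \<phi>), (q, \<phi> + \<delta>)))"
  ultimately have "AE y in lborel. H (T y) = f (snd (snd (T y)) - snd (fst (T y)))"
    by (auto elim!: eventually_mono simp: E_def T_def split: prod.splits)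
  moreover have "T differentiable_on UNIV"
    unfolding T_def differentiable_on_def differentiable_def case_prod_beta
      by (intro ballI exI) (rule derivative_intros)+
  moreover have "x \<in> range T" for x
  proof -
    have "x = T (snd (snd x) - snd (fst x), snd (fst x), fst (fst x), fst (snd x))" by (simp add: T_def)
    then show ?thesis by blast
  qed
  ultimately have "AE x in lborel. H x = f (snd (snd x) - snd (fst x))"
    using AE_lborel_image[of T "\<lambda>x. H x = f (snd (snd x) - snd (fst x))"] by simp
  with per show ?thesis by blast
qed

theorem proposition1:
  fixes F :: "plane set \<times> plane set \<Rightarrow> real"
  assumes "locally_integrable_pairs F"
  shows "motion_invariant_density F \<longleftrightarrow>
    (\<exists>f :: real \<Rightarrow> real. (\<forall>t. f (t + pi) = f t) \<and>
      (AE (G\<^sub>1, G\<^sub>2) in line_pair_measure.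
         F (G\<^sub>1, G\<^sub>2) = f (snd (line_coords G\<^sub>2) - snd (line_coords G\<^sub>1))))"
    (is "_ \<longleftrightarrow> (\<exists>f. ?per f \<and> ?angle f)")
proof -
  have F [measurable]: "F \<in> borel_measurable line_pair_measure"
    using assms by (rule measurable_if_locally_integrable)
  note sf = sigma_finite_line_measure lborel.sigma_finite_measure_axioms
  show ?thesis
    unfolding motion_invariant_density_iff[OF F]
  proof
    assume inv: "\<forall>\<alpha> b. AE x in line_pair_measure. F (move_line_pair (motion \<alpha> b) x) = F x"
    define H where "H = (\<lambda>x. F (chart (fst x), chart (snd x)))"
    have "\<exists>f. (\<forall>t. f (t + pi) = f t) \<and> (AE x in lborel. H x = f (snd (snd x) - snd (fst x)))"
    proof (rule shift_invariant_imp_angle_function)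
      have "(\<lambda>x. (chart (fst x), chart (snd x))) \<in> borel \<Otimes>\<^sub>M borel \<rightarrow>\<^sub>M line_pair_measure"
        unfolding line_pair_measure_def by measurable
      then show "H \<in> borel_measurable borel"
        unfolding H_def borel_prod[symmetric] by measurable
      show "H (c, (q, \<psi> + pi)) = H (c, (- q, \<psi>))" for c q \<psi>
        by (simp add: H_def chart_add_pi)
      show "AE x in lborel. H (shift \<alpha> b (fst x), shift \<alpha> b (snd x)) = H x" for \<alpha> b
      proof -
        have "AE x in lborel \<Otimes>\<^sub>M lborel. F (move_line_pair (motion \<alpha> b) (chart (fst x), chart (snd x)))
            = F (chart (fst x), chart (snd x))"
          using inv[rule_format, of \<alpha> b] unfolding line_pair_measure_def
          by (intro AE_pair_nonsingular[where f = chart and g = chart and N = line_measure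
                and N' = line_measure] sf AE_chart) auto
        moreover have "AE x in lborel \<Otimes>\<^sub>M lborel. (fst (fst x) \<noteq> 0 \<and> fst (shift \<alpha> b (fst x)) \<noteq> 0)
            \<and> (fst (snd x) \<noteq> 0 \<and> fst (shift \<alpha> b (snd x)) \<noteq> 0)"
          by (intro AE_pair_components sf AE_chart_regular)
        ultimately show ?thesis
          unfolding lborel_prod by eventually_elim (simp add: H_def move_line_chart)
      qed
    qed
    then obtain f where f: "?per f" and eq: "AE x in lborel. H x = f (snd (snd x) - snd (fst x))"
      by blast
    have "AE x in line_pair_measure. H (line_coords (fst x), line_coords (snd x))
        = f (snd (line_coords (snd x)) - snd (line_coords (fst x)))"
    proof -
      have "AE x in lborel \<Otimes>\<^sub>M lborel. H x = f (snd (snd x) - snd (fst x))"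
        unfolding lborel_prod by (rule eq)
      from AE_pair_nonsingular[OF sf(1) sf(1) sf(2) sf(2) _ _ _ _ this, of line_coords line_coords]
      show ?thesis
        unfolding line_pair_measure_def by (simp add: AE_line_coords measurable_line_coords_borel)
    qed
    then have "?angle f"
      using AE_space
      by eventually_elim (auto simp: H_def space_line_pair_measure chart_line_coords)
    with f show "\<exists>f. ?per f \<and> ?angle f" by blast
  next
    assume "\<exists>f. ?per f \<and> ?angle f"
    then obtain f where per: "?per f" and eq: "?angle f" by blast
    define \<delta> where "\<delta> = (\<lambda>x. snd (line_coords (snd x)) - snd (line_coords (fst x)))"
    have eq: "AE x in line_pair_measure. F x = f (\<delta> x)"
      using eq by (rule eventually_mono) (auto simp: \<delta>_def)
    show "\<forall>\<alpha> b. AE x in line_pair_measure. F (move_line_pair (motion \<alpha> b) x) = F x"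
    proof (intro allI)
      fix \<alpha> b
      have "AE x in line_pair_measure. F (move_line_pair (motion \<alpha> b) x) = f (\<delta> (move_line_pair (motion \<alpha> b) x))"
        by (rule AE_distrD[OF measurable_move_line_pair]) (subst distr_move_line_pair, rule eq)
      then show "AE x in line_pair_measure. F (move_line_pair (motion \<alpha> b) x) = F x"
        using eq AE_pair_off_origin[of \<alpha> b] AE_space
      proof eventually_elim
        case (elim x)
        obtain G G' where x: "x = (G, G')" by force
        then have lines: "G \<in> lines_off_origin" "G' \<in> lines_off_origin"
          and off: "0 \<notin> motion \<alpha> b ` G" "0 \<notin> motion \<alpha> b ` G'"
          using elim by (auto simp: space_line_pair_measure)
        obtain k k' :: int
          where "snd (line_coords (motion \<alpha> b ` G)) = snd (line_coords G) + \<alpha> + pi * of_int k"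
            and "snd (line_coords (motion \<alpha> b ` G')) = snd (line_coords G') + \<alpha> + pi * of_int k'"
          using line_angle_motion lines off by metis
        then have "\<delta> (move_line_pair (motion \<alpha> b) x) = \<delta> x + pi * of_int (k' - k)"
          using off by (simp add: \<delta>_def x move_line_def algebra_simps)
        then show ?case
          using elim per periodic_int_multiple[of f pi] by metis
      qed
    qed
  qed
qed

end
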